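(* Let $C$ be a constant. There is an algorithm that, given a matching market in the $d$-attribute model in which every attribute value and every weight value of every participant belongs to a fixed set of at most $C$ distinct values, finds a (weakly) stable matching in time $O(C^{2d} n (d + \log n))$.
   Context: A matching market consists of a set $M$ of $n$ men and a set $W$ of $n$ women. In the $d$-attribute model each participant $p$ has attributes $A_1(p),\dots,A_d(p)$ and weights $\alpha_1(p),\dots,\alpha_d(p)$ (real numbers, possibly negative). A man $m$ values a woman $w$ by $\mathrm{val}_m(w)=\sum_{i=1}^d \alpha_i(m)A_i(w)$ and prefers women of larger value; symmetrically $\mathrm{val}_w(m)=\sum_{i=1}^d\alpha_i(w)A_i(m)$. Given a perfect matching $\mu$ between $M$ and $W$, a blocking pair is a pair $(m,w)\notin\mu$ such that $m$ strictly prefers $w$ to $\mu(m)$ and $w$ strictly prefers $m$ to $\mu(w)$; $\mu$ is (weakly) stable if it has no blocking pair. The input has size $O(dn)$. *)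

theory Defs
  imports Complex_Main
begin

section \<open>Matching markets in the attribute model\<close>

text \<open>
  Men and women are both numbered \<open>0, \<dots>, nagents - 1\<close>, attributes \<open>0, \<dots>, nattrs - 1\<close>.
  For instance \<open>man_weight X m i\<close> is the \<open>i\<close>-th weight of man \<open>m\<close>.  Values of the four functions
  outside these ranges are irrelevant.
\<close>

record market =
  nagents :: nat
  nattrs :: nat
  man_attr :: "nat \<Rightarrow> nat \<Rightarrow> real"
  man_weight :: "nat \<Rightarrow> nat \<Rightarrow> real"
  woman_attr :: "nat \<Rightarrow> nat \<Rightarrow> real"
  woman_weight :: "nat \<Rightarrow> nat \<Rightarrow> real"

definition man_val :: "market \<Rightarrow> nat \<Rightarrow> nat \<Rightarrow> real" where
  "man_val X m w = (\<Sum>i<nattrs X. man_weight X m i * woman_attr X w i)"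

definition woman_val :: "market \<Rightarrow> nat \<Rightarrow> nat \<Rightarrow> real" where
  "woman_val X w m = (\<Sum>i<nattrs X. woman_weight X w i * man_attr X m i)"

text \<open>In a matching, the first component of each pair is a man and the second one a woman.\<close>

definition perfect_matching :: "market \<Rightarrow> (nat \<times> nat) set \<Rightarrow> bool" where
  "perfect_matching X \<mu> \<longleftrightarrow>
     \<mu> \<subseteq> {..<nagents X} \<times> {..<nagents X} \<and>
     (\<forall>m<nagents X. \<exists>!w. (m, w) \<in> \<mu>) \<and>
     (\<forall>w<nagents X. \<exists>!m. (m, w) \<in> \<mu>)"

definition blocking_pair :: "market \<Rightarrow> (nat \<times> nat) set \<Rightarrow> nat \<Rightarrow> nat \<Rightarrow> bool" where
  "blocking_pair X \<mu> m w \<longleftrightarrow>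
     m < nagents X \<and> w < nagents X \<and> (m, w) \<notin> \<mu> \<and>
     (\<exists>w'. (m, w') \<in> \<mu> \<and> man_val X m w' < man_val X m w) \<and>
     (\<exists>m'. (m', w) \<in> \<mu> \<and> woman_val X w m' < woman_val X w m)"

definition stable_matching :: "market \<Rightarrow> (nat \<times> nat) set \<Rightarrow> bool" where
  "stable_matching X \<mu> \<longleftrightarrow> perfect_matching X \<mu> \<and> (\<forall>m w. \<not> blocking_pair X \<mu> m w)"

definition values_in :: "market \<Rightarrow> real set \<Rightarrow> bool" where
  "values_in X V \<longleftrightarrow>
     (\<forall>p<nagents X. \<forall>i<nattrs X.
        man_attr X p i \<in> V \<and> man_weight X p i \<in> V \<and>
        woman_attr X p i \<in> V \<and> woman_weight X p i \<in> V)"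


section \<open>A real random access machine\<close>

text \<open>
  Algorithms are programs of a small imperative language for a real RAM at uniform cost.  The memory
  consists of unbounded arrays of natural numbers and unbounded arrays of real numbers, of which
  a program, being a finite term, uses only finitely many; a scalar variable is an array used at
  index \<open>0\<close> only.

  The instruction set is deliberately weak.  On natural numbers there is addition, truncated
  subtraction and halving but no multiplication, so that unit cost arithmetic on long numbers gives
  no more than polynomial power.  On real numbers there is addition, subtraction and multiplication;
  the only real constants are integers, and real numbers influence the control flow and the natural
  numbers only through comparisons (there is no rounding).
\<close>

type_synonym vname = string

record state =
  nmem :: "vname \<Rightarrow> nat \<Rightarrow> nat"
  rmem :: "vname \<Rightarrow> nat \<Rightarrow> real"

datatype nexp =
    NConst nat
  | NRead vname nexp
  | NPlus nexp nexp
  | NMinus nexp nexp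
  | NHalf nexp

datatype rexp =
    RConst int
  | RRead vname nexp
  | RPlus rexp rexp
  | RMinus rexp rexp
  | RTimes rexp rexp

datatype bexp =
    NLess nexp nexp
  | RLess rexp rexp
  | BNot bexp
  | BAnd bexp bexp

datatype com =
    Skip
  | NWrite vname nexp nexp
  | RWrite vname nexp rexp
  | Seq com com
  | If bexp com com
  | While bexp com

primrec nval :: "nexp \<Rightarrow> state \<Rightarrow> nat" where
  "nval (NConst k) s = k"
| "nval (NRead x e) s = nmem s x (nval e s)"
| "nval (NPlus e1 e2) s = nval e1 s + nval e2 s"
| "nval (NMinus e1 e2) s = nval e1 s - nval e2 s"
| "nval (NHalf e) s = nval e s div 2"

primrec rval :: "rexp \<Rightarrow> state \<Rightarrow> real" where
  "rval (RConst k) s = of_int k"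
| "rval (RRead x e) s = rmem s x (nval e s)"
| "rval (RPlus e1 e2) s = rval e1 s + rval e2 s"
| "rval (RMinus e1 e2) s = rval e1 s - rval e2 s"
| "rval (RTimes e1 e2) s = rval e1 s * rval e2 s"

primrec bval :: "bexp \<Rightarrow> state \<Rightarrow> bool" where
  "bval (NLess e1 e2) s = (nval e1 s < nval e2 s)"
| "bval (RLess e1 e2) s = (rval e1 s < rval e2 s)"
| "bval (BNot b) s = (\<not> bval b s)"
| "bval (BAnd b1 b2) s = (bval b1 s \<and> bval b2 s)"

definition nwrite :: "vname \<Rightarrow> nat \<Rightarrow> nat \<Rightarrow> state \<Rightarrow> state" where
  "nwrite x i v s = s\<lparr>nmem := (nmem s)(x := (nmem s x)(i := v))\<rparr>"

definition rwrite :: "vname \<Rightarrow> nat \<Rightarrow> real \<Rightarrow> state \<Rightarrow> state" where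
  "rwrite x i v s = s\<lparr>rmem := (rmem s)(x := (rmem s x)(i := v))\<rparr>"

text \<open>
  \<open>exec c s t s'\<close>: started in \<open>s\<close>, the command \<open>c\<close> terminates in \<open>s'\<close> after \<open>t\<close> steps.  Every write,
  every \<open>Skip\<close> and every evaluation of a branching or loop condition is one step.  The expressions in
  a program have fixed size, so charging for every single operation in them would change the running
  time by at most a constant factor depending on the program.
\<close>

inductive exec :: "com \<Rightarrow> state \<Rightarrow> nat \<Rightarrow> state \<Rightarrow> bool" where
  Skip: "exec Skip s 1 s"
| NWrite: "exec (NWrite x i e) s 1 (nwrite x (nval i s) (nval e s) s)"
| RWrite: "exec (RWrite x i e) s 1 (rwrite x (nval i s) (rval e s) s)"
| Seq: "exec c1 s1 t1 s2 \<Longrightarrow> exec c2 s2 t2 s3 \<Longrightarrow> exec (Seq c1 c2) s1 (t1 + t2) s3"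
| IfTrue: "bval b s \<Longrightarrow> exec c1 s t s' \<Longrightarrow> exec (If b c1 c2) s (1 + t) s'"
| IfFalse: "\<not> bval b s \<Longrightarrow> exec c2 s t s' \<Longrightarrow> exec (If b c1 c2) s (1 + t) s'"
| WhileFalse: "\<not> bval b s \<Longrightarrow> exec (While b c) s 1 s"
| WhileTrue: "bval b s1 \<Longrightarrow> exec c s1 t1 s2 \<Longrightarrow> exec (While b c) s2 t2 s3 \<Longrightarrow>
    exec (While b c) s1 (1 + t1 + t2) s3"

inductive_cases exec_SkipE: "exec Skip s t s'"
inductive_cases exec_NWriteE: "exec (NWrite x i e) s t s'"
inductive_cases exec_RWriteE: "exec (RWrite x i e) s t s'"
inductive_cases exec_SeqE: "exec (Seq c1 c2) s t s'"
inductive_cases exec_IfE: "exec (If b c1 c2) s t s'"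
inductive_cases exec_WhileE: "exec (While b c) s t s'"

lemma exec_deterministic:
  "exec c s t s' \<Longrightarrow> exec c s u s'' \<Longrightarrow> u = t \<and> s'' = s'"
proof (induction arbitrary: u s'' rule: exec.induct)
  case (Seq c1 s1 t1 s2 c2 t2 s3)
  from Seq.prems obtain u1 r u2
    where r: "exec c1 s1 u1 r" "exec c2 r u2 s''" "u = u1 + u2"
    by (rule exec_SeqE)
  from Seq.IH(1)[OF r(1)] have "u1 = t1" "r = s2" by simp_all
  with Seq.IH(2)[of u2 s''] r show ?case by simp
next
  case (IfTrue b s c1 t s' c2)
  from IfTrue.prems IfTrue.hyps(1) obtain u1 where "u = Suc u1" "exec c1 s u1 s''"
    by (auto elim: exec_IfE)
  with IfTrue.IH[of u1 s''] show ?case by simp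
next
  case (IfFalse b s c2 t s' c1)
  from IfFalse.prems IfFalse.hyps(1) obtain u1 where "u = Suc u1" "exec c2 s u1 s''"
    by (auto elim: exec_IfE)
  with IfFalse.IH[of u1 s''] show ?case by simp
next
  case (WhileFalse b s c)
  from WhileFalse.prems WhileFalse.hyps show ?case by (auto elim: exec_WhileE)
next
  case (WhileTrue b s1 c t1 s2 t2 s3)
  from WhileTrue.prems WhileTrue.hyps(1) obtain u1 r u2
    where r: "exec c s1 u1 r" "exec (While b c) r u2 s''" "u = Suc (u1 + u2)"
    by (auto elim: exec_WhileE)
  from WhileTrue.IH(1)[OF r(1)] have "u1 = t1" "r = s2" by simp_all
  with WhileTrue.IH(2)[of u2 s''] r show ?case by simp
next
  case (Skip s)
  from Skip show ?case by (auto elim: exec_SkipE)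
next
  case (NWrite x i e s)
  from NWrite show ?case by (auto elim: exec_NWriteE)
next
  case (RWrite x i e s)
  from RWrite show ?case by (auto elim: exec_RWriteE)
qed


section \<open>Input and output\<close>

text \<open>
  The four tables of the market are stored in row-major order, one row of length \<open>nattrs\<close> for each
  participant.  All memory cells that hold no input are initially \<open>0\<close>.
\<close>

definition table :: "nat \<Rightarrow> nat \<Rightarrow> (nat \<Rightarrow> nat \<Rightarrow> real) \<Rightarrow> nat \<Rightarrow> real" where
  "table n d f k = (if k < n * d then f (k div d) (k mod d) else 0)"

definition input_state :: "market \<Rightarrow> state" where
  "input_state X =
     \<lparr>nmem = (\<lambda>_ _. 0)
        (''n'' := (\<lambda>_. 0)(0 := nagents X),
         ''d'' := (\<lambda>_. 0)(0 := nattrs X)),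
      rmem = (\<lambda>_ _. 0)
        (''man_attr'' := table (nagents X) (nattrs X) (man_attr X),
         ''man_weight'' := table (nagents X) (nattrs X) (man_weight X),
         ''woman_attr'' := table (nagents X) (nattrs X) (woman_attr X),
         ''woman_weight'' := table (nagents X) (nattrs X) (woman_weight X))\<rparr>"

definition output_matching :: "market \<Rightarrow> state \<Rightarrow> (nat \<times> nat) set" where
  "output_matching X s = {(m, nmem s ''mu'' m) | m. m < nagents X}"

end

theory Submission
  imports Defs "HOL-Library.FuncSet"
begin

text \<open>
  Call two men of the same type if both their weight vectors and their attribute vectors agree; there
  are at most \<open>C\<^sup>d * C\<^sup>d\<close> types.  Men with equal weight vectors share one ranking of the women, and a
  ranking has at most \<open>C\<^sup>d\<close> levels of ties, so all rankings together are computed by scanning the women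
  at most \<open>C\<^sup>d * C\<^sup>d\<close> times.  In the men-proposing deferred acceptance algorithm, a woman who has been
  proposed to by a man of some type has, from then on, a partner she likes at least as much as
  every man of this type, whether or not she accepted.  It therefore suffices to keep one pointer into
  the ranking per type instead of one per man, and each proposal advances one of these pointers.  This
  bounds the number of proposals by \<open>C\<^sup>d * C\<^sup>d * n\<close>, and each takes time \<open>O(d)\<close>.
\<close>

section \<open>Running times of structured programs\<close>

text \<open>The program never sees \<open>V\<close> or \<open>C\<close>: a row is grouped by
  comparing it with one representative per class found so far, and \<open>D = card V ^ d\<close>
  occurs only in the analysis. No sorting in time \<open>n log n\<close> takes place either. The
  number of steps is at most a constant multiple of \<open>D * D * n * (d + 1)\<close>, and the
  logarithm in the claim serves only to absorb the \<open>+ 1\<close>.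

  The obstacle to a shared pointer is that a man resumes wherever others of his type have stopped,
  so he passes over women whom he never asked. This is why a type needs both vectors. Equal weights
  alone would give the men one list, with ties broken alike, so that a position means the same woman
  for all of them. Equal attributes make that woman indifferent between them, so that her answer to
  one man answers all.

  Types must also be numbered without multiplication. Class \<open>b\<close> of weights and class
  \<open>a\<close> of attributes give the number \<open>b * n + a\<close>, read from the tabulated
  offsets; it is unambiguous because there are at most \<open>n\<close> classes of each
  kind.\<close>

definition wp :: "com \<Rightarrow> state \<Rightarrow> (nat \<Rightarrow> state \<Rightarrow> bool) \<Rightarrow> bool" where
  "wp c s Q \<longleftrightarrow> (\<exists>t s'. exec c s t s' \<and> Q t s')"

lemma wp_mono: "wp c s P \<Longrightarrow> (\<And>t s'. P t s' \<Longrightarrow> Q t s') \<Longrightarrow> wp c s Q"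
  unfolding wp_def by blast

lemma wp_Skip [simp]: "wp Skip s Q \<longleftrightarrow> Q 1 s"
  unfolding wp_def using exec.Skip by (metis exec_SkipE)

lemma wp_NWrite [simp]: "wp (NWrite x i e) s Q \<longleftrightarrow> Q 1 (nwrite x (nval i s) (nval e s) s)"
  unfolding wp_def using exec.NWrite by (metis exec_NWriteE)

lemma wp_RWrite [simp]: "wp (RWrite x i e) s Q \<longleftrightarrow> Q 1 (rwrite x (nval i s) (rval e s) s)"
  unfolding wp_def using exec.RWrite by (metis exec_RWriteE)

text \<open>The step count is an argument of the postcondition, so a sequence adds the costs there,
  and a time bound is proved together with what the program computes.\<close>

lemma wp_Seq [simp]:
  "wp (Seq c1 c2) s Q \<longleftrightarrow> wp c1 s (\<lambda>t1 s1. wp c2 s1 (\<lambda>t2 s2. Q (t1 + t2) s2))"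
  unfolding wp_def by (blast elim: exec_SeqE intro: exec.Seq)

lemma wp_If [simp]:
  "wp (If b c1 c2) s Q \<longleftrightarrow>
     (if bval b s then wp c1 s (\<lambda>t s'. Q (1 + t) s') else wp c2 s (\<lambda>t s'. Q (1 + t) s'))"
  unfolding wp_def by (auto elim!: exec_IfE intro: exec.IfTrue exec.IfFalse) 
    (metis exec.IfTrue exec.IfFalse plus_1_eq_Suc)+

section \<open>Frame conditions: the memory that a program leaves alone\<close>

primrec nmods :: "com \<Rightarrow> vname set" where
  "nmods Skip = {}"
| "nmods (NWrite x i e) = {x}"
| "nmods (RWrite x i e) = {}"
| "nmods (Seq c1 c2) = nmods c1 \<union> nmods c2"
| "nmods (If b c1 c2) = nmods c1 \<union> nmods c2"
| "nmods (While b c) = nmods c"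

primrec rmods :: "com \<Rightarrow> vname set" where
  "rmods Skip = {}"
| "rmods (NWrite x i e) = {}"
| "rmods (RWrite x i e) = {x}"
| "rmods (Seq c1 c2) = rmods c1 \<union> rmods c2"
| "rmods (If b c1 c2) = rmods c1 \<union> rmods c2"
| "rmods (While b c) = rmods c"

lemma nmem_nwrite [simp]: "nmem (nwrite x i v s) = (nmem s)(x := (nmem s x)(i := v))"
  and rmem_nwrite [simp]: "rmem (nwrite x i v s) = rmem s"
  and nmem_rwrite [simp]: "nmem (rwrite x i r s) = nmem s"
  and rmem_rwrite [simp]: "rmem (rwrite x i r s) = (rmem s)(x := (rmem s x)(i := r))"
  by (simp_all add: nwrite_def rwrite_def)

definition same_but :: "vname set \<Rightarrow> vname set \<Rightarrow> state \<Rightarrow> state \<Rightarrow> bool" where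
  "same_but N R s s' \<longleftrightarrow>
     (\<forall>x. x \<notin> N \<longrightarrow> nmem s' x = nmem s x) \<and> (\<forall>x. x \<notin> R \<longrightarrow> rmem s' x = rmem s x)"

lemma same_butD:
  assumes "same_but N R s s'"
  shows "x \<notin> N \<Longrightarrow> nmem s' x = nmem s x" and "x \<notin> R \<Longrightarrow> rmem s' x = rmem s x"
  using assms by (auto simp: same_but_def)

lemma same_but_refl [simp]: "same_but N R s s"
  by (simp add: same_but_def)

lemma same_but_trans:
  "same_but N R s s' \<Longrightarrow> same_but N' R' s' s'' \<Longrightarrow> N \<subseteq> N'' \<Longrightarrow> N' \<subseteq> N'' \<Longrightarrow> R \<subseteq> R'' \<Longrightarrow> R' \<subseteq> R'' \<Longrightarrow>
    same_but N'' R'' s s''"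
  unfolding same_but_def by (metis subsetD)

lemma exec_same_but: "exec c s t s' \<Longrightarrow> same_but (nmods c) (rmods c) s s'"
  by (induction rule: exec.induct) (auto simp: same_but_def)

text \<open>Lets the frame be attached after a specification has been proved. Most program proofs
  below establish only the time bound and the result and then end in this way.\<close>

lemma wp_same_but: "wp c s Q \<Longrightarrow> wp c s (\<lambda>t s'. Q t s' \<and> same_but (nmods c) (rmods c) s s')"
  unfolding wp_def using exec_same_but by blast

text \<open>One potential \<Phi> serves for termination and for time: its decrease pays for an
  iteration together with its test, and the final failing test is the extra 1. The step may use the
  frame relative to \<open>s0\<close>, so invariants need not mention memory that the body never
  writes. As \<Phi> may depend on the whole state, amortised bounds are covered too.\<close>

lemma wp_While:
  assumes step: "\<And>s. same_but (nmods c) (rmods c) s0 s \<Longrightarrow> I s \<Longrightarrow> bval b s \<Longrightarrow>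
      wp c s (\<lambda>t s'. I s' \<and> t + 1 + \<Phi> s' \<le> \<Phi> s)"
    and "I s0"
  shows "wp (While b c) s0 (\<lambda>t s'. t \<le> \<Phi> s0 + 1 \<and> I s' \<and> \<not> bval b s' \<and>
      same_but (nmods c) (rmods c) s0 s')"
proof -
  have "wp (While b c) s (\<lambda>t s'. t \<le> \<Phi> s + 1 \<and> I s' \<and> \<not> bval b s')"
    if "I s" "same_but (nmods c) (rmods c) s0 s" for s
    using that
  proof (induction "\<Phi> s" arbitrary: s rule: less_induct)
    case less
    show ?case
    proof (cases "bval b s")
      case False
      with less.prems(1) exec.WhileFalse[OF False] show ?thesis
        unfolding wp_def by fastforce
    next
      case True
      obtain t s' where e: "exec c s t s'" and I: "I s'" and t: "t + 1 + \<Phi> s' \<le> \<Phi> s"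
        using step[OF less.prems(2,1) True] unfolding wp_def by blast
      have "same_but (nmods c) (rmods c) s0 s'"
        using same_but_trans[OF less.prems(2) exec_same_but[OF e]] by simp
      from less.hyps[OF _ I this] t obtain u s''
        where "exec (While b c) s' u s''" "u \<le> \<Phi> s' + 1" "I s''" "\<not> bval b s''"
        unfolding wp_def by auto
      with exec.WhileTrue[OF True e] t show ?thesis
        unfolding wp_def by (intro exI[of _ "1 + t + u"] exI[of _ s'']) auto
    qed
  qed
  from wp_same_but[OF this[OF assms(2)]] show ?thesis by simp
qed

abbreviation NV :: "vname \<Rightarrow> nexp" where "NV x \<equiv> NRead x (NConst 0)"
abbreviation RV :: "vname \<Rightarrow> rexp" where "RV x \<equiv> RRead x (NConst 0)"
abbreviation Assign :: "vname \<Rightarrow> nexp \<Rightarrow> com" where "Assign x e \<equiv> NWrite x (NConst 0) e"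
abbreviation RAssign :: "vname \<Rightarrow> rexp \<Rightarrow> com" where "RAssign x e \<equiv> RWrite x (NConst 0) e"

definition For :: "vname \<Rightarrow> vname \<Rightarrow> com \<Rightarrow> com" where
  "For x y c = Seq (Assign x (NConst 0))
     (While (NLess (NV x) (NV y)) (Seq c (Assign x (NPlus (NV x) (NConst 1)))))"

lemma mods_For [simp]: "nmods (For x y c) = insert x (nmods c)" "rmods (For x y c) = rmods c"
  by (auto simp: For_def)

text \<open>The potential is \<open>(N - k) * (T + 2)\<close>, where 2 pays for the test and the
  increment; the outer 2 pays for the initialisation and the last test. \<open>indep\<close> is
  required because the counter is written between two instances of the invariant.\<close>

lemma wp_For:
  assumes step: "\<And>k s. k < N \<Longrightarrow> nmem s x 0 = k \<Longrightarrow> same_but (insert x (nmods c)) (rmods c) s0 s \<Longrightarrow>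
      I k s \<Longrightarrow> wp c s (\<lambda>t s'. t \<le> T \<and> I (Suc k) s')"
    and indep: "\<And>k v s. I k s \<Longrightarrow> I k (nwrite x 0 v s)"
    and x: "x \<notin> nmods c" "y \<notin> nmods c" "x \<noteq> y"
    and N: "nmem s0 y 0 = N" and I0: "I 0 s0"
  shows "wp (For x y c) s0
     (\<lambda>t s'. t \<le> N * (T + 2) + 2 \<and> I N s' \<and> same_but (insert x (nmods c)) (rmods c) s0 s')"
proof -
  define c' where "c' = Seq c (Assign x (NPlus (NV x) (NConst 1)))"
  have m: "nmods c' = insert x (nmods c)" "rmods c' = rmods c" by (auto simp: c'_def)
  let ?J = "\<lambda>s. nmem s x 0 \<le> N \<and> nmem s y 0 = N \<and> I (nmem s x 0) s"
  let ?s = "nwrite x 0 0 s0"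
  have s: "same_but (insert x (nmods c)) (rmods c) s0 ?s" by (simp add: same_but_def)
  have 1: "wp c' s (\<lambda>t s'. ?J s' \<and> t + 1 + (N - nmem s' x 0) * (T + 2) \<le> (N - nmem s x 0) * (T + 2))"
    if sb: "same_but (nmods c') (rmods c') ?s s" and J: "?J s" and b: "bval (NLess (NV x) (NV y)) s" for s
  proof -
    have k: "nmem s x 0 < N" using J b by simp
    have sb': "same_but (insert x (nmods c)) (rmods c) s0 s"
      using same_but_trans[OF s sb[unfolded m]] by blast
    have "wp c s (\<lambda>t s'. (t \<le> T \<and> I (Suc (nmem s x 0)) s') \<and> same_but (nmods c) (rmods c) s s')"
      by (rule wp_same_but, rule step) (use J k sb' in auto)
    then show ?thesis
      unfolding c'_def wp_Seq
    proof (rule wp_mono, goal_cases)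
      case (1 t s')
      then have "nmem s' x = nmem s x" "nmem s' y = nmem s y" 
        using x by (auto simp: same_but_def)
      moreover have "(N - nmem s x 0) * (T + 2) = (N - Suc (nmem s x 0)) * (T + 2) + (T + 2)"
        using k by (metis Suc_diff_Suc add.commute mult_Suc)
      ultimately show ?case using 1 k J x(3) by (auto intro: indep)
    qed
  qed
  have J0: "?J ?s" using N x(3) indep[OF I0, of 0] by simp
  have "wp (While (NLess (NV x) (NV y)) c') ?s
     (\<lambda>t s'. t \<le> (N - nmem ?s x 0) * (T + 2) + 1 \<and> ?J s' \<and> \<not> bval (NLess (NV x) (NV y)) s' \<and>
        same_but (nmods c') (rmods c') ?s s')"
    by (rule wp_While[where I = ?J and \<Phi> = "\<lambda>s. (N - nmem s x 0) * (T + 2)"], rule 1) (use J0 in auto)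
  then have "wp (For x y c) s0 (\<lambda>t s'. t \<le> N * (T + 2) + 2 \<and> ?J s' \<and> \<not> bval (NLess (NV x) (NV y)) s')"
    unfolding For_def c'_def[symmetric] wp_Seq wp_NWrite nval.simps by (rule wp_mono) auto
  from wp_same_but[OF this] show ?thesis
    by (rule wp_mono) (auto simp: le_antisym)
qed


section \<open>Grouping participants by their vectors\<close>

lemma table_row: "k < n \<Longrightarrow> i < d \<Longrightarrow> table n d f (k * d + i) = f k i"
proof -
  assume "k < n" "i < d"
  then have "k * d + i < n * d"
    by (metis add.commute add_less_cancel_left less_le_trans mult.commute mult_Suc_right mult_le_mono2 Suc_leI)
  with \<open>i < d\<close> show ?thesis by (simp add: table_def)
qed

text \<open>
  The machine cannot multiply natural numbers, so row offsets are tabulated by repeated addition.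
\<close>

definition multiples :: "vname \<Rightarrow> vname \<Rightarrow> com" where
  "multiples y x = For ''i'' ''n''
     (NWrite y (NPlus (NV ''i'') (NConst 1)) (NPlus (NRead y (NV ''i'')) (NV x)))"

lemma mods_multiples: "nmods (multiples y x) = {''i'', y}" "rmods (multiples y x) = {}"
  by (auto simp: multiples_def)

text \<open>Cell 0 of \<open>y\<close> is never written; its value is right because memory starts at
  0.\<close>

lemma wp_multiples:
  assumes "nmem s0 ''n'' 0 = n" "nmem s0 x 0 = d" "nmem s0 y 0 = 0"
    and "y \<notin> {''i'', ''n'', x}" "x \<noteq> ''i''"
  shows "wp (multiples y x) s0 (\<lambda>t s. t \<le> n * 3 + 2 \<and> (\<forall>k\<le>n. nmem s y k = k * d) \<and>
    same_but (nmods (multiples y x)) (rmods (multiples y x)) s0 s)"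
proof -
  let ?I = "\<lambda>k s. \<forall>j\<le>k. nmem s y j = j * d"
  have "wp (multiples y x) s0 (\<lambda>t s. t \<le> n * (1 + 2) + 2 \<and> ?I n s \<and> 
     same_but (insert ''i'' {y}) {} s0 s)"
    unfolding multiples_def
  proof (rule wp_For[where c = "NWrite _ _ _", unfolded nmods.simps rmods.simps, where I = ?I], goal_cases)
    case (1 k s)
    have "nmem s x = nmem s0 x" using same_butD(1)[OF 1(3)] assms by auto
    then show ?case using 1 assms by (auto simp: le_Suc_eq)
  qed (use assms in auto)
  then show ?thesis by (rule wp_mono) (auto simp: mods_multiples)
qed

definition dot :: "vname \<Rightarrow> vname \<Rightarrow> vname \<Rightarrow> vname \<Rightarrow> vname \<Rightarrow> com" where
  "dot r t1 x1 t2 x2 = Seq (RAssign r (RConst 0)) (For ''i'' ''d''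
     (RAssign r (RPlus (RV r) (RTimes
        (RRead t1 (NPlus (NRead ''row'' (NV x1)) (NV ''i'')))
        (RRead t2 (NPlus (NRead ''row'' (NV x2)) (NV ''i'')))))))"

lemma mods_dot: "nmods (dot r t1 x1 t2 x2) = {''i''}" "rmods (dot r t1 x1 t2 x2) = {r}"
  by (auto simp: dot_def)

lemma wp_dot:
  assumes d: "nmem s0 ''d'' 0 = d" and row: "\<forall>k\<le>n. nmem s0 ''row'' k = k * d"
    and t: "rmem s0 t1 = table n d f" "rmem s0 t2 = table n d g"
    and x: "nmem s0 x1 0 < n" "nmem s0 x2 0 < n"
    and ne: "r \<noteq> t1" "r \<noteq> t2" "x1 \<noteq> ''i''" "x2 \<noteq> ''i''"
  shows "wp (dot r t1 x1 t2 x2) s0 (\<lambda>t s. t \<le> d * 3 + 3 \<and>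
    rmem s r 0 = (\<Sum>i<d. f (nmem s0 x1 0) i * g (nmem s0 x2 0) i) \<and>
    same_but (nmods (dot r t1 x1 t2 x2)) (rmods (dot r t1 x1 t2 x2)) s0 s)"
proof -
  let ?I = "\<lambda>k s. rmem s r 0 = (\<Sum>i<k. f (nmem s0 x1 0) i * g (nmem s0 x2 0) i)"
  have "wp (dot r t1 x1 t2 x2) s0 (\<lambda>t s. t \<le> d * 3 + 3 \<and> ?I d s)"
    unfolding dot_def wp_Seq wp_RWrite nval.simps
  proof (rule wp_mono[OF wp_For[where T = 1 and N = d and I = ?I]], goal_cases)
    case (1 k s)
    note fr = same_butD[OF 1(3)]
    have "rmem s t1 = table n d f" "rmem s t2 = table n d g"
      "nmem s x1 = nmem s0 x1" "nmem s x2 = nmem s0 x2" "nmem s ''row'' = nmem s0 ''row''"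
      using fr t ne by auto
    then show ?case using 1 row x by (simp add: table_row)
  qed (use d in auto)
  from wp_same_but[OF this] show ?thesis by (rule wp_mono) auto
qed

text \<open>The preset class number \<open>cnt\<close> means that no representative has matched, and
  it is already the correct number if a new class has to be opened. Two negated comparisons replace
  the test for equality of reals, which the machine offers only through \<open><\<close>.\<close>

definition classify :: "vname \<Rightarrow> vname \<Rightarrow> vname \<Rightarrow> vname \<Rightarrow> com" where
  "classify tb cls rep cnt = Seq (Assign cnt (NConst 0)) (For ''m'' ''n''
     (Seq (NWrite cls (NV ''m'') (NV cnt))
     (Seq (For ''j'' cnt
        (Seq (Assign ''eq'' (NConst 1))
        (Seq (For ''i'' ''d''
           (If (BAnd
              (BNot (RLess (RRead tb (NPlus (NRead ''row'' (NV ''m'')) (NV ''i'')))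
                 (RRead tb (NPlus (NRead ''row'' (NRead rep (NV ''j''))) (NV ''i'')))))
              (BNot (RLess (RRead tb (NPlus (NRead ''row'' (NRead rep (NV ''j''))) (NV ''i'')))
                 (RRead tb (NPlus (NRead ''row'' (NV ''m'')) (NV ''i''))))))
            Skip (Assign ''eq'' (NConst 0))))
        (If (NLess (NConst 0) (NV ''eq'')) (NWrite cls (NV ''m'') (NV ''j'')) Skip))))
     (If (NLess (NRead cls (NV ''m'')) (NV cnt)) Skip
        (Seq (NWrite rep (NV cnt) (NV ''m'')) (Assign cnt (NPlus (NV cnt) (NConst 1))))))))"

lemma mods_classify:
  "nmods (classify tb cls rep cnt) = {''m'', ''j'', ''i'', ''eq'', cls, rep, cnt}"
  "rmods (classify tb cls rep cnt) = {}"
  by (auto simp: classify_def)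

definition same_row :: "nat \<Rightarrow> (nat \<Rightarrow> nat \<Rightarrow> real) \<Rightarrow> nat \<Rightarrow> nat \<Rightarrow> bool" where
  "same_row d f k l \<longleftrightarrow> (\<forall>i<d. f k i = f l i)"

definition classified ::
  "nat \<Rightarrow> (nat \<Rightarrow> nat \<Rightarrow> real) \<Rightarrow> nat \<Rightarrow> (nat \<Rightarrow> nat) \<Rightarrow> (nat \<Rightarrow> nat) \<Rightarrow> nat \<Rightarrow> bool" where
  "classified d f n cls rep c \<longleftrightarrow>
     (\<forall>k<n. cls k < c \<and> same_row d f k (rep (cls k))) \<and>
     (\<forall>j<c. rep j < n) \<and> (\<forall>j<c. \<forall>j'<c. same_row d f (rep j) (rep j') \<longrightarrow> j = j')"

text \<open>The representatives have pairwise different rows, so they inject into the functions from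
  \<open>{..<d}\<close> to \<open>V\<close>; the rows are restricted because entries beyond
  \<open>d\<close> are arbitrary. The bound by \<open>n\<close> later keeps class numbers inside the
  table of offsets and makes pairs of them encodable in base \<open>n\<close>.\<close>

lemma classified_card:
  assumes "classified d f n cls rep c" and V: "finite V" "\<And>k i. k < n \<Longrightarrow> i < d \<Longrightarrow> f k i \<in> V"
  shows "c \<le> n" "c \<le> card V ^ d"
proof -
  have rep: "rep j < n" if "j < c" for j using assms that by (auto simp: classified_def)
  have inj: "j = j'" if "j < c" "j' < c" "same_row d f (rep j) (rep j')" for j j'
    using assms that by (auto simp: classified_def)
  have "inj_on rep {..<c}" "rep ` {..<c} \<subseteq> {..<n}"
    using inj rep by (auto intro!: inj_onI simp: same_row_def)
  from card_inj_on_le[OF this] show "c \<le> n" by simp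
  let ?g = "\<lambda>j. restrict (f (rep j)) {..<d}"
  have "inj_on ?g {..<c}"
  proof (rule inj_onI)
    fix j j' assume "j \<in> {..<c}" "j' \<in> {..<c}" and e: "?g j = ?g j'"
    moreover have "same_row d f (rep j) (rep j')"
      unfolding same_row_def using e by (metis lessThan_iff restrict_apply')
    ultimately show "j = j'" using inj by simp
  qed
  moreover have "?g ` {..<c} \<subseteq> {..<d} \<rightarrow>\<^sub>E V" using rep V(2)
    unfolding image_subset_iff by (auto simp only: restrict_PiE_iff lessThan_iff)
  ultimately have "card {..<c} \<le> card ({..<d} \<rightarrow>\<^sub>E V)"
    by (intro card_inj_on_le[where f = ?g] finite_PiE) (auto simp: V)
  then show "c \<le> card V ^ d" by (simp add: card_PiE)
qed

lemma classified_Suc_old: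
  assumes "classified d f n cls rep c" "j < c" "same_row d f n (rep j)"
  shows "classified d f (Suc n) (cls(n := j)) rep c"
  using assms by (auto simp: classified_def less_Suc_eq)

lemma classified_Suc_new:
  assumes "classified d f n cls rep c" "\<And>j. j < c \<Longrightarrow> \<not> same_row d f n (rep j)"
  shows "classified d f (Suc n) (cls(n := c)) (rep(c := n)) (Suc c)"
  using assms by (auto simp: classified_def less_Suc_eq same_row_def) metis+

lemma wp_classify:
  assumes d: "nmem s0 ''d'' 0 = d" and row: "\<forall>k\<le>n. nmem s0 ''row'' k = k * d"
    and n: "nmem s0 ''n'' 0 = n" and tb: "rmem s0 tb = table n d f"
    and V: "finite V" "\<And>k i. k < n \<Longrightarrow> i < d \<Longrightarrow> f k i \<in> V"
    and ne: "distinct [cls, rep, cnt, ''n'', ''d'', ''row'', ''m'', ''j'', ''i'', ''eq'']"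
  shows "wp (classify tb cls rep cnt) s0 (\<lambda>t s. t \<le> n * (card V ^ d * (4 * d + 7) + 8) + 3 \<and>
    classified d f n (nmem s cls) (nmem s rep) (nmem s cnt 0) \<and>
    same_but (nmods (classify tb cls rep cnt)) (rmods (classify tb cls rep cnt)) s0 s)"
proof -
  let ?I = "\<lambda>k s. classified d f k (nmem s cls) (nmem s rep) (nmem s cnt 0)"
  let ?D = "card V ^ d"
  have "wp (classify tb cls rep cnt) s0 (\<lambda>t s. t \<le> n * (?D * (4 * d + 7) + 8) + 3 \<and> ?I n s)"
    unfolding classify_def wp_Seq wp_NWrite nval.simps
  proof (rule wp_mono[OF wp_For[where T = "?D * (4 * d + 7) + 6" and N = n and I = ?I]], goal_cases)
    case (1 m s1)
    note fr = same_butD[OF 1(3)]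
    have s1: "nmem s1 ''d'' 0 = d" "\<forall>k\<le>n. nmem s1 ''row'' k = k * d" "rmem s1 tb = table n d f"
      using ne by (auto simp: fr d row tb)
    define c rp where "c = nmem s1 cnt 0" and "rp = nmem s1 rep"
    have cl: "classified d f m (nmem s1 cls) rp c" using 1 by (simp add: c_def rp_def)
    \<comment> \<open>At every stage the classes found classify the first \<open>m\<close> rows, so
      the bound on their number holds during the run and not only at its end.\<close>
    have c: "c \<le> ?D" by (rule classified_card[OF cl V(1)]) (use V 1 in auto)
    have rp: "rp j < m" if "j < c" for j using cl that by (auto simp: classified_def)
    \<comment> \<open>The first alternative is the preset number, kept while no representative has
      matched; after a match the second one holds for good.\<close>
    let ?J = "\<lambda>j s. (\<forall>k. k \<noteq> m \<longrightarrow> nmem s cls k = nmem s1 cls k) \<and>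
       (nmem s cls m = c \<and> (\<forall>j'<j. \<not> same_row d f m (rp j')) \<or>
        nmem s cls m < c \<and> same_row d f m (rp (nmem s cls m)))"
    show ?case
      unfolding wp_Seq wp_NWrite
    proof (rule wp_mono[OF wp_For[where T = "4 * d + 5" and N = c and I = ?J]], goal_cases)
      case (1 j s2)
      note fr = same_butD[OF 1(3)]
      have s2: "nmem s2 ''d'' 0 = d" "\<forall>k\<le>n. nmem s2 ''row'' k = k * d" "rmem s2 tb = table n d f"
         "nmem s2 ''m'' 0 = m" "nmem s2 rep = rp"
        using ne \<open>nmem s1 ''m'' 0 = m\<close> by (auto simp: fr s1 rp_def)
      let ?K = "\<lambda>i s. nmem s ''eq'' 0 > 0 \<longleftrightarrow> (\<forall>i'<i. f m i' = f (rp j) i')"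
      show ?case
        unfolding wp_Seq wp_NWrite nval.simps
      proof (rule wp_mono[OF wp_For[where T = "2" and N = d and I = ?K]], goal_cases)
        case (1 i s3)
        note fr = same_butD[OF 1(3)]
        have s3: "nmem s3 ''row'' = nmem s2 ''row''" "rmem s3 tb = table n d f"
         "nmem s3 ''m'' 0 = m" "nmem s3 rep = rp" "nmem s3 ''j'' 0 = j"
          using ne \<open>nmem s2 ''j'' 0 = j\<close> by (auto simp: fr s2)
        have "m < n" "rp j < n" using \<open>m < n\<close> rp[OF \<open>j < c\<close>] by auto
        then show ?case using 1 s2 s3
          by (auto simp: table_row less_Suc_eq)
      next
        case (8 t s3)
        then have K: "?K d s3" by simp
        have "same_but {''i'', ''eq''} {} s2 s3"
          using 8 by (auto simp: same_but_def)
        note fr = same_butD[OF this]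
        have "nmem s3 ''m'' 0 = m" "nmem s3 ''j'' 0 = j" "nmem s3 cls = nmem s2 cls"
          using ne \<open>nmem s2 ''j'' 0 = j\<close> by (auto simp: fr s2)
        moreover have "?J j s2" "j < c" using 1 by auto
        ultimately show ?case using 8 K by (auto simp: less_Suc_eq same_row_def fun_eq_iff)
      qed (use s2 ne in auto)
    next
      case (8 t s2)
      then have J: "?J c s2" and t: "t \<le> c * (4 * d + 5 + 2) + 2" by auto
      have "same_but {''i'', ''eq'', ''j'', cls} {} s1 s2"
        using 8 by (auto simp: same_but_def)
      note fr = same_butD[OF this]
      have s2: "nmem s2 ''m'' 0 = m" "nmem s2 cnt 0 = c" "nmem s2 rep = rp"
        using ne \<open>nmem s1 ''m'' 0 = m\<close> by (auto simp: fr c_def rp_def)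
      have "c * (4 * d + 5 + 2) \<le> ?D * (4 * d + 5 + 2)" using c by (rule mult_le_mono1)
      moreover have "4 * d + 5 + 2 = 4 * d + 7" by simp
      ultimately have t': "t \<le> ?D * (4 * d + 7) + 2" using t by (metis add_le_mono1 order_trans)
      have cls: "(nmem s1 cls)(m := nmem s2 cls m) = nmem s2 cls" using J by auto
      show ?case
      proof (cases "nmem s2 cls m < c")
        case True
        with J have "same_row d f m (rp (nmem s2 cls m))" by auto
        with classified_Suc_old[OF cl True] cls have "classified d f (Suc m) (nmem s2 cls) rp c" by simp
        with s2 t' True show ?thesis by auto
      next
        case False
        with J have c: "nmem s2 cls m = c" and "\<And>j'. j' < c \<Longrightarrow> \<not> same_row d f m (rp j')" by auto
        with classified_Suc_new[OF cl] cls
        have "classified d f (Suc m) (nmem s2 cls) (rp(c := m)) (Suc c)" by simp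
        with s2 t' ne c show ?thesis by auto
      qed
    qed (use ne \<open>nmem s1 ''m'' 0 = m\<close> in \<open>auto simp: c_def\<close>)
  next
    case (8 t s)
    have "t \<le> n * (?D * (4 * d + 7) + 6 + 2) + 2" using 8 by blast
    then have "1 + t \<le> n * (?D * (4 * d + 7) + 8) + 3" by (simp only: add.assoc) simp
    then show ?case using 8 by blast
  qed (use n ne in \<open>auto simp: classified_def\<close>)
  from wp_same_but[OF this] show ?thesis by (rule wp_mono) auto
qed


section \<open>Ranking the women\<close>

definition sorted_part :: "(nat \<Rightarrow> real) \<Rightarrow> nat \<Rightarrow> (nat \<Rightarrow> nat) \<Rightarrow> nat \<Rightarrow> (nat \<Rightarrow> nat) \<Rightarrow> bool" where
  "sorted_part v n u k p \<longleftrightarrow> bij_betw p {..<k} {w. w < n \<and> u w \<noteq> 0} \<and>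
     (\<forall>i<k. \<forall>j<i. v (p i) \<le> v (p j))"

definition sorted_order :: "(nat \<Rightarrow> real) \<Rightarrow> nat \<Rightarrow> (nat \<Rightarrow> nat) \<Rightarrow> bool" where
  "sorted_order v n p \<longleftrightarrow> bij_betw p {..<n} {..<n} \<and> (\<forall>i<n. \<forall>j<i. v (p i) \<le> v (p j))"

lemma sorted_part_Suc:
  assumes s: "sorted_part v n u k p" and w: "w < n" "u w = 0"
    and le: "\<And>x. x < n \<Longrightarrow> u x \<noteq> 0 \<Longrightarrow> v w \<le> v x"
  shows "sorted_part v n (u(w := Suc 0)) (Suc k) (p(k := w))"
proof -
  have b: "bij_betw p {..<k} {w. w < n \<and> u w \<noteq> 0}" using s by (simp add: sorted_part_def)
  then have b': "bij_betw (p(k := w)) {..<k} {w. w < n \<and> u w \<noteq> 0}"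
    by (subst bij_betw_cong[of _ _ p]) auto
  have "bij_betw (p(k := w)) ({..<k} \<union> {k}) ({w. w < n \<and> u w \<noteq> 0} \<union> {w})"
    using w by (intro bij_betw_combine[OF b']) auto
  moreover have "{..<k} \<union> {k} = {..<Suc k}" "{w. w < n \<and> u w \<noteq> 0} \<union> {w} = {x. x < n \<and> (u(w := Suc 0)) x \<noteq> 0}"
    using w by auto
  moreover have "v w \<le> v (p j)" if "j < k" for j
    using bij_betwE[OF b] that le by auto
  ultimately show ?thesis using s by (auto simp: sorted_part_def less_Suc_eq)
qed

text \<open>All by counting, as \<open>k\<close> is the number of marked women. The second claim
  makes the search for a best unlisted woman succeed while the loop runs; the third turns the end of
  the loop into a complete ranking.\<close>

lemma sorted_part_card:
  assumes "sorted_part v n u k p"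
  shows "k \<le> n" and "k < n \<Longrightarrow> \<exists>w<n. u w = 0"
    and "n \<le> k \<Longrightarrow> sorted_order v n p"
proof -
  have b: "bij_betw p {..<k} {w. w < n \<and> u w \<noteq> 0}" using assms by (simp add: sorted_part_def)
  have k: "k = card {w. w < n \<and> u w \<noteq> 0}" using bij_betw_same_card[OF b] by simp
  have sub: "{w. w < n \<and> u w \<noteq> 0} \<subseteq> {..<n}" by auto
  show le: "k \<le> n" using card_mono[OF _ sub] k by simp
  show "\<exists>w<n. u w = 0" if "k < n"
  proof (rule ccontr)
    assume "\<not> ?thesis"
    then have "{w. w < n \<and> u w \<noteq> 0} = {..<n}" by auto
    with that k show False by simp
  qed
  show "sorted_order v n p" if "n \<le> k"
  proof -
    have "{w. w < n \<and> u w \<noteq> 0} = {..<n}" using card_subset_eq[OF _ sub] k that le by simp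
    with b assms le that show ?thesis by (simp add: sorted_part_def sorted_order_def)
  qed
qed

lemma sorted_order_cong:
  assumes "sorted_order v n p" and "\<And>w. w < n \<Longrightarrow> v w = v' w" "\<And>i. i < n \<Longrightarrow> p i = p' i"
  shows "sorted_order v' n p'"
proof -
  have "bij_betw p {..<n} {..<n}" using assms(1) by (simp add: sorted_order_def)
  then have b': "bij_betw p' {..<n} {..<n}" by (subst bij_betw_cong[of _ _ p]) (use assms in auto)
  have "v' (p' i) \<le> v' (p' j)" if "i < n" "j < i" for i j
  proof -
    have "p' i < n" "p' j < n" using bij_betwE[OF b'] that by auto
    moreover have "v (p i) \<le> v (p j)" using assms(1) that by (simp add: sorted_order_def)
    ultimately show ?thesis using assms(2,3) that by simp
  qed
  with b' show ?thesis by (simp add: sorted_order_def)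
qed

section \<open>Programs that compute the ranking of one weight class\<close>

definition fill_values :: com where
  "fill_values = For ''w'' ''n'' (Seq (dot ''acc'' ''man_weight'' ''r'' ''woman_attr'' ''w'')
     (Seq (RWrite ''val'' (NV ''w'') (RV ''acc'')) (NWrite ''used'' (NV ''w'') (NConst 0))))"

lemma mods_fill_values:
  "nmods fill_values = {''w'', ''i'', ''used''}" "rmods fill_values = {''acc'', ''val''}"
  by (auto simp: fill_values_def mods_dot)

lemma wp_fill_values:
  assumes d: "nmem s0 ''d'' 0 = d" and row: "\<forall>k\<le>n. nmem s0 ''row'' k = k * d"
    and n: "nmem s0 ''n'' 0 = n" and r: "nmem s0 ''r'' 0 = r" "r < n"
    and t: "rmem s0 ''man_weight'' = table n d f" "rmem s0 ''woman_attr'' = table n d g"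
  shows "wp fill_values s0 (\<lambda>t s. t \<le> n * (3 * d + 7) + 2 \<and>
    (\<forall>w<n. rmem s ''val'' w = (\<Sum>i<d. f r i * g w i) \<and> nmem s ''used'' w = 0) \<and>
    same_but (nmods fill_values) (rmods fill_values) s0 s)"
proof -
  let ?I = "\<lambda>k s. \<forall>w<k. rmem s ''val'' w = (\<Sum>i<d. f r i * g w i) \<and> nmem s ''used'' w = 0"
  have "wp fill_values s0 (\<lambda>t s. t \<le> n * (3 * d + 7) + 2 \<and> ?I n s)"
    unfolding fill_values_def
  proof (rule wp_mono[OF wp_For[where T = "3 * d + 5" and N = n and I = ?I]], goal_cases)
    case (1 w s)
    note fr = same_butD[OF 1(3), simplified mods_dot nmods.simps rmods.simps]
    show ?case unfolding wp_Seq
    proof (rule wp_mono[OF wp_dot[where n = n and d = d and f = f and g = g]], goal_cases)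
      case (11 t s')
      note fr' = same_butD[OF 11[THEN conjunct2, THEN conjunct2], unfolded mods_dot]
      have "nmem s' ''w'' 0 = w" "nmem s' ''used'' = nmem s ''used''" "rmem s' ''val'' = rmem s ''val''"
        using 1 by (simp_all add: fr')
      then show ?case using 11 1 by (auto simp: fr r less_Suc_eq)
    qed (use 1 in \<open>simp_all add: fr d row n t r\<close>)
  qed (simp_all add: n mods_dot algebra_simps)
  from wp_same_but[OF this] show ?thesis by (rule wp_mono) auto
qed

text \<open>The number \<open>n\<close>, which is no woman, stands for the absence of a
  candidate.\<close>

definition find_best :: com where
  "find_best = Seq (Assign ''best'' (NV ''n'')) (For ''w'' ''n''
     (If (NLess (NRead ''used'' (NV ''w'')) (NConst 1))
        (If (BAnd (NLess (NV ''best'') (NV ''n''))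
               (BNot (RLess (RRead ''val'' (NV ''best'')) (RRead ''val'' (NV ''w'')))))
           Skip (Assign ''best'' (NV ''w'')))
        Skip))"

lemma mods_find_best: "nmods find_best = {''w'', ''best''}" "rmods find_best = {}"
  by (auto simp: find_best_def)

lemma wp_find_best:
  assumes n: "nmem s0 ''n'' 0 = n" and ex: "\<exists>w<n. nmem s0 ''used'' w = 0"
  shows "wp find_best s0 (\<lambda>t s. t \<le> 5 * n + 3 \<and>
    nmem s ''best'' 0 < n \<and> nmem s0 ''used'' (nmem s ''best'' 0) = 0 \<and>
    (\<forall>w<n. nmem s0 ''used'' w = 0 \<longrightarrow> rmem s0 ''val'' w \<le> rmem s0 ''val'' (nmem s ''best'' 0)) \<and>
    same_but (nmods find_best) (rmods find_best) s0 s)"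
proof -
  let ?u = "nmem s0 ''used''" and ?v = "rmem s0 ''val''"
  let ?I = "\<lambda>k s. (nmem s ''best'' 0 = n \<and> (\<forall>w<k. ?u w \<noteq> 0)) \<or>
     (nmem s ''best'' 0 < n \<and> ?u (nmem s ''best'' 0) = 0 \<and>
      (\<forall>w<k. ?u w = 0 \<longrightarrow> ?v w \<le> ?v (nmem s ''best'' 0)))"
  have "wp find_best s0 (\<lambda>t s. t \<le> 5 * n + 3 \<and> ?I n s)"
    unfolding find_best_def wp_Seq wp_NWrite
  proof (rule wp_mono[OF wp_For[where T = 3 and N = n and I = ?I]], goal_cases)
    case (1 k s)
    note fr = same_butD[OF 1(3), simplified]
    have "nmem s ''used'' = ?u" "rmem s ''val'' = ?v" "nmem s ''n'' 0 = n"
      by (simp_all add: fr n)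
    with 1 show ?case by (fastforce simp: less_Suc_eq)
  qed (use n in auto)
  from wp_same_but[OF this] show ?thesis by (rule wp_mono) (use ex in auto)
qed

text \<open>
  All women tied with the best remaining one are appended in a single pass.  Hence the number of
  passes is the number of distinct values, which is bounded by the number of attribute vectors.
\<close>

definition append_ties :: com where
  "append_ties = For ''w'' ''n''
     (If (BAnd (NLess (NRead ''used'' (NV ''w'')) (NConst 1))
            (BNot (RLess (RRead ''val'' (NV ''w'')) (RRead ''val'' (NV ''best'')))))
        (Seq (NWrite ''order'' (NPlus (NRead ''off'' (NV ''b'')) (NV ''k'')) (NV ''w''))
        (Seq (NWrite ''used'' (NV ''w'') (NConst 1))
           (Assign ''k'' (NPlus (NV ''k'') (NConst 1)))))
        Skip)"

lemma mods_append_ties: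
  "nmods append_ties = {''w'', ''order'', ''used'', ''k''}" "rmods append_ties = {}"
  by (auto simp: append_ties_def)

lemma wp_append_ties:
  assumes n: "nmem s0 ''n'' 0 = n" and q: "nmem s0 ''off'' (nmem s0 ''b'' 0) = q"
    and v: "rmem s0 ''val'' = v" and L: "v (nmem s0 ''best'' 0) = L"
    and sorted: "sorted_part v n (nmem s0 ''used'') (nmem s0 ''k'' 0) (\<lambda>i. nmem s0 ''order'' (q + i))"
    and used: "\<And>w. w < n \<Longrightarrow> nmem s0 ''used'' w \<noteq> 0 \<Longrightarrow> L \<le> v w"
    and unused: "\<And>w. w < n \<Longrightarrow> nmem s0 ''used'' w = 0 \<Longrightarrow> v w \<le> L"
  shows "wp append_ties s0 (\<lambda>t s. t \<le> 6 * n + 2 \<and>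
    sorted_part v n (nmem s ''used'') (nmem s ''k'' 0) (\<lambda>i. nmem s ''order'' (q + i)) \<and>
    (\<forall>w<n. nmem s ''used'' w \<noteq> 0 \<longrightarrow> L \<le> v w) \<and>
    (\<forall>w<n. nmem s ''used'' w = 0 \<longrightarrow> v w < L) \<and>
    (\<forall>w. nmem s0 ''used'' w \<noteq> 0 \<longrightarrow> nmem s ''used'' w \<noteq> 0) \<and>
    (\<forall>i<q. nmem s ''order'' i = nmem s0 ''order'' i) \<and>
    same_but (nmods append_ties) (rmods append_ties) s0 s)"
proof -
  let ?I = "\<lambda>j s. sorted_part v n (nmem s ''used'') (nmem s ''k'' 0) (\<lambda>i. nmem s ''order'' (q + i)) \<and>
    (\<forall>w<n. nmem s ''used'' w \<noteq> 0 \<longrightarrow> L \<le> v w) \<and>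
    (\<forall>w<j. nmem s ''used'' w = 0 \<longrightarrow> v w < L) \<and>
    (\<forall>w. nmem s0 ''used'' w \<noteq> 0 \<longrightarrow> nmem s ''used'' w \<noteq> 0) \<and>
    (\<forall>i<q. nmem s ''order'' i = nmem s0 ''order'' i)"
  have "wp append_ties s0 (\<lambda>t s. t \<le> 6 * n + 2 \<and> ?I n s)"
    unfolding append_ties_def
  proof (rule wp_mono[OF wp_For[where T = 4 and N = n and I = ?I]], goal_cases)
    case (1 j s)
    note fr = same_butD[OF 1(3), simplified]
    have s: "nmem s ''off'' (nmem s ''b'' 0) = q" "rmem s ''val'' = v" "v (nmem s ''best'' 0) = L" "nmem s ''w'' 0 = j"
      using 1(2) by (simp_all add: fr q v L)
    show ?case
    proof (cases "nmem s ''used'' j = 0 \<and> \<not> v j < L")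
      case True
      \<comment> \<open>Marks are never removed, so \<open>j\<close> was unlisted at the start,
        where \<open>L\<close> is the maximum. Together with the failed comparison her value is
        exactly \<open>L\<close>, and appending her keeps the list descending.\<close>
      have "nmem s0 ''used'' j = 0" using 1(4) True by blast
      then have "v j \<le> L" using unused[OF 1(1)] by simp
      then have "v j \<le> v x" if "x < n" "nmem s ''used'' x \<noteq> 0" for x
        using 1(4) that by (meson order_trans)
      from sorted_part_Suc[OF 1(4)[THEN conjunct1] \<open>j < n\<close> _ this] True
      have sp: "sorted_part v n ((nmem s ''used'')(j := Suc 0)) (Suc (nmem s ''k'' 0))
         ((\<lambda>i. nmem s ''order'' (q + i))(nmem s ''k'' 0 := j))" by simp
      have eq: "(\<lambda>i. ((nmem s ''order'')(q + nmem s ''k'' 0 := j)) (q + i)) =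
         (\<lambda>i. nmem s ''order'' (q + i))(nmem s ''k'' 0 := j)" by auto
      show ?thesis using True 1 s sp by (auto simp: eq[simplified] less_Suc_eq)
    next
      case False
      then show ?thesis using 1 s by (auto simp: less_Suc_eq)
    qed
  qed (use n sorted used in auto)
  from wp_same_but[OF this] show ?thesis by (rule wp_mono) auto
qed

definition sort_women :: com where
  "sort_women = Seq (Assign ''r'' (NRead ''wrep'' (NV ''b'')))
     (Seq fill_values
     (Seq (Assign ''k'' (NConst 0))
        (While (NLess (NV ''k'') (NV ''n'')) (Seq find_best append_ties))))"

lemma mods_sort_women:
  "nmods sort_women = {''r'', ''w'', ''i'', ''used'', ''k'', ''best'', ''order''}"
  "rmods sort_women = {''acc'', ''val''}"
  by (auto simp: sort_women_def mods_fill_values mods_find_best mods_append_ties)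

text \<open>The value of a woman is a function of her attribute vector, so there are no more values
  than functions from \<open>{..<d}\<close> to \<open>V\<close>. This bounds the number of tie
  levels, hence of passes.\<close>

lemma card_vals_le:
  assumes "finite V" "\<And>w i. w < n \<Longrightarrow> i < d \<Longrightarrow> g w i \<in> V"
  shows "card ((\<lambda>w. \<Sum>i<d. a i * g w i :: real) ` {..<n}) \<le> card V ^ d"
proof -
  have "(\<lambda>w. \<Sum>i<d. a i * g w i) ` {..<n} \<subseteq> (\<lambda>h. \<Sum>i<d. a i * h i) ` ({..<d} \<rightarrow>\<^sub>E V)"
  proof (intro image_subsetI)
    fix w assume "w \<in> {..<n}"
    then have "restrict (g w) {..<d} \<in> {..<d} \<rightarrow>\<^sub>E V"
      using assms by (simp only: restrict_PiE_iff) auto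
    then show "(\<Sum>i<d. a i * g w i) \<in> (\<lambda>h. \<Sum>i<d. a i * h i) ` ({..<d} \<rightarrow>\<^sub>E V)"
      by (rule rev_image_eqI) simp
  qed
  then have "card ((\<lambda>w. \<Sum>i<d. a i * g w i) ` {..<n}) \<le> card ({..<d} \<rightarrow>\<^sub>E V)"
    by (meson surj_card_le finite_PiE finite_lessThan assms(1))
  then show ?thesis by (simp add: card_PiE)
qed

lemma wp_sort_women:
  assumes d: "nmem s0 ''d'' 0 = d" and row: "\<forall>k\<le>n. nmem s0 ''row'' k = k * d"
    and n: "nmem s0 ''n'' 0 = n" and r: "nmem s0 ''wrep'' (nmem s0 ''b'' 0) = r" "r < n"
    and t: "rmem s0 ''man_weight'' = table n d f" "rmem s0 ''woman_attr'' = table n d g"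
    and q: "nmem s0 ''off'' (nmem s0 ''b'' 0) = q"
    and V: "finite V" "\<And>w i. w < n \<Longrightarrow> i < d \<Longrightarrow> g w i \<in> V"
  shows "wp sort_women s0 (\<lambda>t s. t \<le> n * (3 * d + 7) + card V ^ d * (11 * n + 6) + 5 \<and>
    sorted_order (\<lambda>w. \<Sum>i<d. f r i * g w i) n (\<lambda>i. nmem s ''order'' (q + i)) \<and>
    (\<forall>i<q. nmem s ''order'' i = nmem s0 ''order'' i) \<and>
    same_but (nmods sort_women) (rmods sort_women) s0 s)"
proof -
  let ?val = "\<lambda>w. \<Sum>i<d. f r i * g w i"
  have "wp sort_women s0 (\<lambda>t s. t \<le> n * (3 * d + 7) + card V ^ d * (11 * n + 6) + 5 \<and>
    sorted_order ?val n (\<lambda>i. nmem s ''order'' (q + i)) \<and>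
    (\<forall>i<q. nmem s ''order'' i = nmem s0 ''order'' i))"
    unfolding sort_women_def wp_Seq wp_NWrite nval.simps
  proof (rule wp_mono[OF wp_fill_values[where d = d and n = n and r = r and f = f and g = g]], goal_cases)
    case (8 t1 s1)
    note fr = same_butD[OF 8[THEN conjunct2, THEN conjunct2], unfolded mods_fill_values]
    define v where "v = rmem s1 ''val''"
    have v: "v w = ?val w" if "w < n" for w using 8 that by (simp add: v_def)
    let ?I = "\<lambda>s. sorted_part v n (nmem s ''used'') (nmem s ''k'' 0) (\<lambda>i. nmem s ''order'' (q + i)) \<and>
      (\<forall>w<n. \<forall>w'<n. nmem s ''used'' w \<noteq> 0 \<longrightarrow> nmem s ''used'' w' = 0 \<longrightarrow> v w' \<le> v w) \<and>
      (\<forall>i<q. nmem s ''order'' i = nmem s0 ''order'' i)"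
    \<comment> \<open>Potential: the number of distinct values among unlisted women, each worth one
      pass, that is \<open>5 * n + 3\<close> plus \<open>6 * n + 2\<close> steps and a loop
      test.\<close>
    let ?un = "\<lambda>s. v ` {w. w < n \<and> nmem s ''used'' w = 0}"
    let ?\<Phi> = "\<lambda>s. card (?un s) * (11 * n + 6)"
    let ?s2 = "nwrite ''k'' 0 0 s1"
    show ?case
    proof (rule wp_mono[OF wp_While[where I = ?I and \<Phi> = ?\<Phi>]], goal_cases)
      case (1 s)
      note fr2 = same_butD[OF 1(1), simplified mods_find_best mods_append_ties nmods.simps rmods.simps]
      have s: "nmem s ''n'' 0 = n" "nmem s ''off'' (nmem s ''b'' 0) = q" "rmem s ''val'' = v"
        by (simp_all add: fr2 fr n q v_def)
      have "nmem s ''k'' 0 < n" using 1(3) s by simp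
      note ex = sorted_part_card(2)[OF 1(2)[THEN conjunct1] this]
      show ?case unfolding wp_Seq
      proof (rule wp_mono[OF wp_find_best[OF s(1) ex]], goal_cases)
        case (1 t3 s3)
        note fr3 = same_butD[OF 1[THEN conjunct2, THEN conjunct2, THEN conjunct2, THEN conjunct2],
          unfolded mods_find_best]
        have s3: "nmem s3 ''used'' = nmem s ''used''" "nmem s3 ''k'' = nmem s ''k''" "nmem s3 ''order'' = nmem s ''order''"
          by (simp_all add: fr3)
        define L where "L = v (nmem s3 ''best'' 0)"
        show ?case
        proof (rule wp_mono[OF wp_append_ties[where n = n and q = q and v = v and L = L]], goal_cases)
          case (8 t4 s4)
          \<comment> \<open>The pass uses up the level \<open>L\<close> of the best unlisted woman:
            afterwards all unlisted women lie strictly below it.\<close>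
          have "L \<in> ?un s" using 1 by (auto simp: L_def)
          moreover have "L \<notin> ?un s4" using 8 by auto
          moreover have "\<forall>w. nmem s ''used'' w \<noteq> 0 \<longrightarrow> nmem s4 ''used'' w \<noteq> 0" using 8 s3 by simp
          then have "?un s4 \<subseteq> ?un s" by blast
          ultimately have "card (?un s4) < card (?un s)" by (intro psubset_card_mono) auto
          then have "Suc (card (?un s4)) * (11 * n + 6) \<le> ?\<Phi> s" by (intro mult_le_mono1) simp
          then have "t3 + t4 + 1 + ?\<Phi> s4 \<le> ?\<Phi> s" using 1 8 by simp
          \<comment> \<open>\<open>L\<close> separates listed from unlisted women.\<close>
          moreover have "v w' \<le> v w" if "w < n" "w' < n" "nmem s4 ''used'' w \<noteq> 0" "nmem s4 ''used'' w' = 0" for w w'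
            by (rule order_trans[of _ L]) (use 8 that in \<open>auto intro: less_imp_le\<close>)
          moreover have "nmem s4 ''order'' i = nmem s0 ''order'' i" if "i < q" for i
            using 8 s3 \<open>?I s\<close> that by simp
          then have "?I s4" using 8 calculation by blast
          ultimately show ?case by simp
        qed (use 1 s \<open>?I s\<close> in \<open>auto simp: fr3 L_def\<close>)
      qed
    next
      case 2
      have "nmem s1 ''order'' = nmem s0 ''order''" by (simp add: fr)
      moreover have "{w. w < n \<and> nmem s1 ''used'' w \<noteq> 0} = {}" using 8 by auto
      then have "sorted_part v n (nmem s1 ''used'') 0 p" for p
        unfolding sorted_part_def by (simp add: bij_betw_def)
      ultimately show ?case using 8 by simp
    next
      case (3 t s)
      have "nmem s ''n'' 0 = n"
        using same_butD(1)[OF 3[THEN conjunct2, THEN conjunct2, THEN conjunct2], of "''n''"]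
        by (simp add: mods_find_best mods_append_ties fr n)
      moreover have "?un ?s2 = ?val ` {..<n}" using 8 v by (auto simp: image_iff)
      then have \<Phi>: "?\<Phi> ?s2 \<le> card V ^ d * (11 * n + 6)"
        using card_vals_le[where V = V and n = n and d = d and g = g and a = "f r", OF V] by (intro mult_le_mono1) simp
      moreover have "sorted_order ?val n (\<lambda>i. nmem s ''order'' (q + i))"
        by (rule sorted_order_cong[OF sorted_part_card(3)[OF 3[THEN conjunct2, THEN conjunct1, THEN conjunct1]]])
          (use 3 v \<open>nmem s ''n'' 0 = n\<close> in auto)
      moreover have "\<forall>i<q. nmem s ''order'' i = nmem s0 ''order'' i" using 3 by blast
      moreover have "t1 \<le> n * (3 * d + 7) + 2" "t \<le> ?\<Phi> ?s2 + 1" using 3 8 by blast+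
      with \<Phi> have "1 + (t1 + (1 + t)) \<le> n * (3 * d + 7) + card V ^ d * (11 * n + 6) + 5" by linarith
      ultimately show ?case by blast
    qed
  qed (simp_all add: d n row r t)
  from wp_same_but[OF this] show ?thesis by (rule wp_mono) auto
qed

section \<open>The rankings of all weight classes in one array\<close>

definition sort_all :: com where
  "sort_all = For ''b'' ''wcnt'' sort_women"

lemma mods_sort_all:
  "nmods sort_all = insert ''b'' (nmods sort_women)" "rmods sort_all = rmods sort_women"
  by (auto simp: sort_all_def)

lemma wp_sort_all:
  assumes d: "nmem s0 ''d'' 0 = d" and row: "\<forall>k\<le>n. nmem s0 ''row'' k = k * d"
    and n: "nmem s0 ''n'' 0 = n"
    and B: "nmem s0 ''wcnt'' 0 = B" "B \<le> n" and r: "\<And>b. b < B \<Longrightarrow> nmem s0 ''wrep'' b < n"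
    and t: "rmem s0 ''man_weight'' = table n d f" "rmem s0 ''woman_attr'' = table n d g"
    and off: "\<forall>k\<le>n. nmem s0 ''off'' k = k * n"
    and V: "finite V" "\<And>w i. w < n \<Longrightarrow> i < d \<Longrightarrow> g w i \<in> V"
  shows "wp sort_all s0 (\<lambda>t s. t \<le> B * (n * (3 * d + 7) + card V ^ d * (11 * n + 6) + 7) + 2 \<and>
    (\<forall>b<B. sorted_order (\<lambda>w. \<Sum>i<d. f (nmem s0 ''wrep'' b) i * g w i) n (\<lambda>i. nmem s ''order'' (b * n + i))) \<and>
    same_but (nmods sort_all) (rmods sort_all) s0 s)"
proof -
  let ?I = "\<lambda>b s. \<forall>b'<b. sorted_order (\<lambda>w. \<Sum>i<d. f (nmem s0 ''wrep'' b') i * g w i) n 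
      (\<lambda>i. nmem s ''order'' (b' * n + i))"
  have "wp sort_all s0 (\<lambda>t s. t \<le> B * (n * (3 * d + 7) + card V ^ d * (11 * n + 6) + 7) + 2 \<and> ?I B s)"
    unfolding sort_all_def
  proof (rule wp_mono[OF wp_For[where T = "n * (3 * d + 7) + card V ^ d * (11 * n + 6) + 5" and N = B and I = ?I]], goal_cases)
    case (1 b s)
    note fr = same_butD[OF 1(3), simplified mods_sort_women]
    show ?case
    proof (rule wp_mono[OF wp_sort_women[where d = d and n = n and r = "nmem s0 ''wrep'' b" and q = "b * n"
         and f = f and g = g and V = V]], goal_cases)
      case (11 t s')
      \<comment> \<open>Earlier rankings occupy cells below \<open>b * n\<close>, and ranking class
        \<open>b\<close> writes only from there on.\<close>
      have "sorted_order v n (\<lambda>i. nmem s' ''order'' (b' * n + i))"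
        if "b' < b" "sorted_order v n (\<lambda>i. nmem s ''order'' (b' * n + i))" for b' v
      proof (rule sorted_order_cong[OF that(2)])
        fix i assume "i < n"
        moreover have "Suc b' * n \<le> b * n" using that(1) by (intro mult_le_mono1) simp
        ultimately have "b' * n + i < b * n" by simp
        then show "nmem s ''order'' (b' * n + i) = nmem s' ''order'' (b' * n + i)" using 11 by simp
      qed simp
      then show ?case using 11 1 by (auto simp: less_Suc_eq)
    qed (use 1 B r off V in \<open>simp_all add: fr d n row t\<close>)
  qed (use B in \<open>simp_all add: mods_sort_women algebra_simps\<close>)
  from wp_same_but[OF this] show ?thesis by (rule wp_mono) auto
qed


section \<open>Deferred acceptance with one pointer per type\<close>

text \<open>
  The men \<open>0, \<dots>, nxt\<close> except \<open>m\<close> are matched.  \<open>hus w\<close> is \<open>0\<close> if \<open>w\<close> is single and \<open>Suc h\<close> if she is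
  matched to \<open>h\<close>.  \<open>ptr\<close> is indexed by types \<open>ty k\<close>, not by men: every woman before the pointer has a
  partner she likes at least as much as any man of that type.
\<close>

definition proposals_inv :: "nat \<Rightarrow> (nat \<Rightarrow> nat) \<Rightarrow> (nat \<Rightarrow> nat \<Rightarrow> nat) \<Rightarrow> (nat \<Rightarrow> nat \<Rightarrow> real) \<Rightarrow>
    (nat \<Rightarrow> nat) \<Rightarrow> (nat \<Rightarrow> nat) \<Rightarrow> (nat \<Rightarrow> nat) \<Rightarrow> nat \<Rightarrow> nat \<Rightarrow> bool" where
  "proposals_inv n ty ord wv mu hus ptr m nxt \<longleftrightarrow>
     m \<le> nxt \<and> nxt \<le> n \<and> (nxt = n \<longrightarrow> m = n) \<and>
     (\<forall>k\<le>nxt. k \<noteq> m \<longrightarrow> mu k < n \<and> hus (mu k) = Suc k \<and> (\<exists>i<ptr (ty k). mu k = ord k i)) \<and>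
     (\<forall>w<n. \<forall>h. hus w = Suc h \<longrightarrow> h \<le> nxt \<and> h \<noteq> m \<and> mu h = w) \<and>
     (\<forall>k<n. ptr (ty k) \<le> n \<and> (\<forall>i<ptr (ty k). \<exists>h. hus (ord k i) = Suc h \<and> wv (ord k i) k \<le> wv (ord k i) h))"

lemma proposals_invD:
  assumes "proposals_inv n ty ord wv mu hus ptr m nxt"
  shows "m \<le> nxt" "nxt \<le> n" "nxt = n \<Longrightarrow> m = n"
    and "k \<le> nxt \<Longrightarrow> k \<noteq> m \<Longrightarrow> mu k < n"
    and "k \<le> nxt \<Longrightarrow> k \<noteq> m \<Longrightarrow> hus (mu k) = Suc k"
    and "k \<le> nxt \<Longrightarrow> k \<noteq> m \<Longrightarrow> \<exists>i<ptr (ty k). mu k = ord k i"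
    and "w < n \<Longrightarrow> hus w = Suc h \<Longrightarrow> h \<le> nxt"
    and "w < n \<Longrightarrow> hus w = Suc h \<Longrightarrow> h \<noteq> m"
    and "w < n \<Longrightarrow> hus w = Suc h \<Longrightarrow> mu h = w"
    and "k < n \<Longrightarrow> ptr (ty k) \<le> n"
    and "k < n \<Longrightarrow> i < ptr (ty k) \<Longrightarrow> \<exists>h. hus (ord k i) = Suc h \<and> wv (ord k i) k \<le> wv (ord k i) h"
  using assms unfolding proposals_inv_def by blast+

text \<open>
  Otherwise every woman would be matched, although fewer than \<open>n\<close> men are.
\<close>

lemma proposals_ptr_less:
  assumes inv: "proposals_inv n ty ord wv mu hus ptr m nxt" and nxt: "nxt < n"
    and ord: "bij_betw (ord m) {..<n} {..<n}"
  shows "ptr (ty m) < n"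
proof (rule ccontr)
  assume "\<not> ?thesis"
  have m: "m \<le> nxt" by (rule proposals_invD(1)[OF inv])
  then have mn: "m < n" using nxt by simp
  then have p: "ptr (ty m) = n" using proposals_invD(10)[OF inv mn] \<open>\<not> ptr (ty m) < n\<close> by linarith
  define h where "h w = hus w - 1" for w
  have h: "h w \<le> nxt \<and> h w \<noteq> m \<and> mu (h w) = w" if "w < n" for w
  proof -
    have "w \<in> ord m ` {..<n}" unfolding bij_betw_imp_surj_on[OF ord] using that by simp
    then obtain i where i: "i < n" "ord m i = w" by blast
    have "i < ptr (ty m)" using i(1) p by simp
    then obtain g where g: "hus w = Suc g" using proposals_invD(11)[OF inv mn] i(2) by blast
    show ?thesis unfolding h_def g using proposals_invD(7-9)[OF inv that g] by simp
  qed
  have inj: "inj_on h {..<n}"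
    by (rule inj_on_inverseI[of _ mu]) (simp add: h)
  have "h ` {..<n} \<subseteq> {..nxt} - {m}"
    using h by auto
  from card_inj_on_le[OF inj this] have "card {..<n} \<le> card ({..nxt} - {m})" by simp
  then show False using m nxt by simp
qed

text \<open>Whatever \<open>w\<close> answers, she ends with a partner at least as good as
  \<open>m\<close>, so the pointer may move in all three outcomes, a refusal included. They differ
  in who is free afterwards: the next man, the displaced husband, or still \<open>m\<close>.\<close>

lemma proposals_step:
  assumes inv: "proposals_inv n ty ord wv mu hus ptr m nxt" and nxt: "nxt < n"
    and ord: "\<forall>k<n. bij_betw (ord k) {..<n} {..<n}"
    and ty: "\<forall>k<n. \<forall>l<n. ty k = ty l \<longrightarrow> ord k = ord l \<and> (\<forall>w<n. wv w k = wv w l)"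
    and w: "w = ord m (ptr (ty m))" and ptr': "ptr' = ptr(ty m := Suc (ptr (ty m)))"
  shows proposals_free: "hus w = 0 \<Longrightarrow>
      proposals_inv n ty ord wv (mu(m := w)) (hus(w := Suc m)) ptr' (Suc nxt) (Suc nxt)"
    and proposals_accept: "hus w = Suc h \<Longrightarrow> wv w h < wv w m \<Longrightarrow>
      proposals_inv n ty ord wv (mu(m := w)) (hus(w := Suc m)) ptr' h nxt"
    and proposals_reject: "hus w = Suc h \<Longrightarrow> wv w m \<le> wv w h \<Longrightarrow>
      proposals_inv n ty ord wv mu hus ptr' m nxt"
proof -
  note inv_facts = proposals_invD[OF inv]
  have m: "m \<le> nxt" "m < n" using inv_facts(1) nxt by auto
  note ord = ord[rule_format] and ty = ty[rule_format]
  have p: "ptr (ty m) < n" using proposals_ptr_less[OF inv nxt ord[OF m(2)]] .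
  have wn: "w < n" using bij_betwE[OF ord[OF m(2)]] p w by auto
  have le: "ptr k \<le> ptr' k" for k by (simp add: ptr')
  have mu: "mu k < n" "hus (mu k) = Suc k" "\<exists>i<ptr' (ty k). mu k = ord k i" if "k \<le> nxt" "k \<noteq> m" for k
  proof -
    show "mu k < n" "hus (mu k) = Suc k" using inv_facts(4,5) that by auto
    obtain i where "i < ptr (ty k)" "mu k = ord k i" using inv_facts(6)[OF \<open>k \<le> nxt\<close> \<open>k \<noteq> m\<close>] by blast
    then show "\<exists>i<ptr' (ty k). mu k = ord k i" using le[of "ty k"] less_le_trans by blast
  qed
  have hus: "h \<le> nxt" "h \<noteq> m" "mu h = w'" if "w' < n" "hus w' = Suc h" for w' h
    using inv_facts(7-9)[OF that] by auto
  have ptr: "\<exists>h. hus (ord k i) = Suc h \<and> wv (ord k i) k \<le> wv (ord k i) h"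
    if "k < n" "i < ptr (ty k)" for k i
    by (rule inv_facts(11)[OF that])
  have ptr'_n: "ptr' (ty k) \<le> n" if "k < n" for k
    using inv_facts(10)[OF that] p by (simp add: ptr')
  have new: "\<exists>i<ptr' (ty m). w = ord m i" by (auto simp: ptr' w)
  \<comment> \<open>Common to the three cases: if no woman becomes worse off and \<open>w\<close>
    has somebody at least as good as \<open>m\<close>, the pointer condition survives the advance.
    \<open>hus'\<close> stands for the husbands afterwards.\<close>
  have better: "\<exists>h. hus' (ord k i) = Suc h \<and> wv (ord k i) k \<le> wv (ord k i) h"
    if "k < n" "i < ptr' (ty k)"
      and old: "\<And>w' h. w' < n \<Longrightarrow> hus w' = Suc h \<Longrightarrow> \<exists>h'. hus' w' = Suc h' \<and> wv w' h \<le> wv w' h'"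
      and w: "\<exists>h'. hus' w = Suc h' \<and> wv w m \<le> wv w h'" for k i hus'
  proof (cases "i < ptr (ty k)")
    case True
    have "i < n" using that ptr'_n[of k] by simp
    then have "ord k i < n" using bij_betwE[OF ord[OF \<open>k < n\<close>]] by auto
    with old ptr[OF \<open>k < n\<close> True] show ?thesis by (meson order_trans)
  next
    case False
    \<comment> \<open>The one new position concerns every man of the type of \<open>m\<close>: by
      \<open>ty\<close> it holds the same \<open>w\<close> for each of them, and she values them all
      like \<open>m\<close>.\<close>
    then have "ty k = ty m" "i = ptr (ty m)" using that by (auto simp: ptr' split: if_splits)
    with ty[OF \<open>k < n\<close> \<open>m < n\<close>] \<open>w = ord m _\<close> w wn show ?thesis by auto
  qed
  show "proposals_inv n ty ord wv (mu(m := w)) (hus(w := Suc m)) ptr' (Suc nxt) (Suc nxt)" if "hus w = 0"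
  proof -
    have "\<exists>h. (hus(w := Suc m)) (ord k i) = Suc h \<and> wv (ord k i) k \<le> wv (ord k i) h"
      if "k < n" "i < ptr' (ty k)" for k i
      by (rule better[OF that]) (use \<open>hus w = 0\<close> in auto)
    moreover have "mu k \<noteq> w" if "k \<le> nxt" "k \<noteq> m" for k
      using mu(2)[OF that] \<open>hus w = 0\<close> by auto
    moreover have "hus w' \<noteq> Suc (Suc nxt)" if "w' < n" for w'
      using hus(1)[OF that] by auto
    ultimately show ?thesis
      unfolding proposals_inv_def using m nxt wn mu hus ptr'_n new that by (auto simp: le_Suc_eq)
  qed
  show "proposals_inv n ty ord wv (mu(m := w)) (hus(w := Suc m)) ptr' h nxt"
    if "hus w = Suc h" "wv w h < wv w m"
  proof -
    have "\<exists>h. (hus(w := Suc m)) (ord k i) = Suc h \<and> wv (ord k i) k \<le> wv (ord k i) h"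
      if "k < n" "i < ptr' (ty k)" for k i
      by (rule better[OF that]) (use \<open>hus w = Suc h\<close> \<open>wv w h < wv w m\<close> in auto)
    moreover have "mu k \<noteq> w" if "k \<le> nxt" "k \<noteq> m" "k \<noteq> h" for k
      using mu(2)[of k] that \<open>hus w = Suc h\<close> by auto
    \<comment> \<open>Since \<open>mu h = w\<close>, no other woman has \<open>h\<close> as her
      husband, so after the exchange he is really free.\<close>
    moreover have "h' \<noteq> h" if "hus w' = Suc h'" "w' < n" "w' \<noteq> w" for w' h'
      using hus(3)[of w' h'] hus(3)[OF wn \<open>hus w = Suc h\<close>] that by auto
    ultimately show ?thesis
      unfolding proposals_inv_def using m nxt wn mu hus ptr'_n new that by auto
  qed
  show "proposals_inv n ty ord wv mu hus ptr' m nxt" if "hus w = Suc h" "wv w m \<le> wv w h"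
  proof -
    have "\<exists>h. hus (ord k i) = Suc h \<and> wv (ord k i) k \<le> wv (ord k i) h"
      if "k < n" "i < ptr' (ty k)" for k i
      by (rule better[OF that]) (use \<open>hus w = Suc h\<close> \<open>wv w m \<le> wv w h\<close> in auto)
    then show ?thesis
      unfolding proposals_inv_def using m nxt mu hus ptr'_n by auto
  qed
qed

text \<open>If \<open>k\<close> strictly prefers \<open>w\<close> to \<open>mu k\<close>, then
  \<open>w\<close> comes earlier in his ranking. The position of \<open>mu k\<close> lies before the
  pointer of his type, hence so does that of \<open>w\<close>, and the invariant says that her
  partner is at least as good as \<open>k\<close>.\<close>

lemma proposals_stable:
  assumes inv: "proposals_inv n ty ord (woman_val X) mu hus ptr m n" and n: "n = nagents X"
    and ord: "\<And>k. k < n \<Longrightarrow> sorted_order (man_val X k) n (ord k)"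
  shows "stable_matching X {(k, mu k) | k. k < n}"
proof -
  note inv_facts = proposals_invD[OF inv]
  \<comment> \<open>With \<open>nxt = n\<close> the free man is the fictitious man \<open>n\<close>,
    so every real man is matched.\<close>
  have mu: "mu k < n" "hus (mu k) = Suc k" "\<exists>i<ptr (ty k). mu k = ord k i" if "k < n" for k
    using inv_facts(3) inv_facts(4-6)[of k] that by auto
  have inj: "inj_on mu {..<n}" by (rule inj_on_inverseI[of _ "\<lambda>w. hus w - 1"]) (simp add: mu(2))
  moreover have "mu ` {..<n} \<subseteq> {..<n}" using mu(1) by auto
  ultimately have surj: "mu ` {..<n} = {..<n}" by (simp add: endo_inj_surj)
  have "perfect_matching X {(k, mu k) | k. k < n}"
    unfolding perfect_matching_def n[symmetric]
  proof (intro conjI allI impI)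
    fix w assume "w < n"
    then obtain k where "k < n" "w = mu k" using surj by (metis imageE lessThan_iff)
    then show "\<exists>!k. (k, w) \<in> {(k, mu k) | k. k < n}" using inj by (auto simp: inj_on_def)
  qed (use mu(1) in auto)
  moreover have "\<not> blocking_pair X {(k, mu k) | k. k < n} k w" for k w
  proof
    assume "blocking_pair X {(k, mu k) | k. k < n} k w"
    then obtain l where k: "k < n" "w < n" "man_val X k (mu k) < man_val X k w"
      and l: "l < n" "w = mu l" "woman_val X w l < woman_val X w k"
      by (auto simp: blocking_pair_def n)
    obtain i where i: "i < ptr (ty k)" "mu k = ord k i" using mu(3)[OF k(1)] by blast
    obtain j where j: "j < n" "w = ord k j"
      using ord[OF k(1)] k(2) unfolding sorted_order_def by (metis bij_betw_imp_surj_on imageE lessThan_iff)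
    have "j < i"
    proof (rule ccontr)
      assume "\<not> j < i"
      then have "i = j \<or> i < j" by auto
      then have "man_val X k w \<le> man_val X k (mu k)"
        using ord[OF k(1)] i j by (auto simp: sorted_order_def)
      with k(3) show False by simp
    qed
    then obtain h where "hus w = Suc h" "woman_val X w k \<le> woman_val X w h"
      using inv_facts(11)[OF k(1), of j] i(1) j(2) by auto
    moreover have "hus w = Suc l" using mu(2)[OF l(1)] l(2) by simp
    ultimately show False using l(3) by simp
  qed
  ultimately show ?thesis by (simp add: stable_matching_def)
qed

text \<open>\<open>''t''\<close> is the number of the type of the proposer. Husbands are stored plus
  one, so that initial memory means that all women are single. The entry of a displaced man in
  \<open>''mu''\<close> is left stale, which the invariant tolerates because it says nothing about
  the partner of the free man.\<close>

definition propose :: com where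
  "propose = Seq (Assign ''t'' (NPlus (NRead ''off'' (NRead ''wc'' (NV ''m''))) (NRead ''ac'' (NV ''m''))))
     (Seq (Assign ''w'' (NRead ''order'' (NPlus (NRead ''off'' (NRead ''wc'' (NV ''m''))) (NRead ''ptr'' (NV ''t'')))))
     (Seq (NWrite ''ptr'' (NV ''t'') (NPlus (NRead ''ptr'' (NV ''t'')) (NConst 1)))
     (If (NLess (NConst 0) (NRead ''hus'' (NV ''w'')))
        (Seq (Assign ''h'' (NMinus (NRead ''hus'' (NV ''w'')) (NConst 1)))
        (Seq (dot ''x'' ''woman_weight'' ''w'' ''man_attr'' ''h'')
        (Seq (dot ''y'' ''woman_weight'' ''w'' ''man_attr'' ''m'')
        (If (RLess (RV ''x'') (RV ''y''))
           (Seq (NWrite ''hus'' (NV ''w'') (NPlus (NV ''m'') (NConst 1)))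
           (Seq (NWrite ''mu'' (NV ''m'') (NV ''w''))
              (Assign ''m'' (NV ''h''))))
           Skip))))
        (Seq (NWrite ''hus'' (NV ''w'') (NPlus (NV ''m'') (NConst 1)))
        (Seq (NWrite ''mu'' (NV ''m'') (NV ''w''))
        (Seq (Assign ''nxt'' (NPlus (NV ''nxt'') (NConst 1)))
           (Assign ''m'' (NV ''nxt''))))))))"

lemma mods_propose:
  "nmods propose = {''t'', ''w'', ''ptr'', ''h'', ''i'', ''hus'', ''mu'', ''m'', ''nxt''}"
  "rmods propose = {''x'', ''y''}"
  by (auto simp: propose_def mods_dot)

text \<open>The equation for \<open>''ptr''\<close> is exported because the amortised analysis
  counts pointer moves.\<close>

lemma wp_propose:
  assumes ty_def: "ty = (\<lambda>k. nmem s0 ''wc'' k * n + nmem s0 ''ac'' k)"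
    and ord_def: "ord = (\<lambda>k i. nmem s0 ''order'' (nmem s0 ''wc'' k * n + i))"
    and d: "nmem s0 ''d'' 0 = d" and row: "\<forall>k\<le>n. nmem s0 ''row'' k = k * d"
    and t: "rmem s0 ''woman_weight'' = table n d f" "rmem s0 ''man_attr'' = table n d g"
    and off: "\<forall>k\<le>n. nmem s0 ''off'' k = k * n"
    and wc: "\<And>k. k < n \<Longrightarrow> nmem s0 ''wc'' k < n"
    and wv: "\<And>w k. wv w k = (\<Sum>i<d. f w i * g k i)"
    and inv: "proposals_inv n ty ord wv (nmem s0 ''mu'') (nmem s0 ''hus'') (nmem s0 ''ptr'') (nmem s0 ''m'' 0) (nmem s0 ''nxt'' 0)"
    and nxt: "nmem s0 ''nxt'' 0 < n"
    and ord: "\<forall>k<n. bij_betw (ord k) {..<n} {..<n}"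
    and ty: "\<forall>k<n. \<forall>l<n. ty k = ty l \<longrightarrow> ord k = ord l \<and> (\<forall>w<n. wv w k = wv w l)"
  shows "wp propose s0 (\<lambda>t s. t \<le> 6 * d + 15 \<and>
    proposals_inv n ty ord wv (nmem s ''mu'') (nmem s ''hus'') (nmem s ''ptr'') (nmem s ''m'' 0) (nmem s ''nxt'' 0) \<and>
    nmem s ''ptr'' = (nmem s0 ''ptr'')(ty (nmem s0 ''m'' 0) := Suc (nmem s0 ''ptr'' (ty (nmem s0 ''m'' 0)))) \<and>
    same_but (nmods propose) (rmods propose) s0 s)"
proof -
  define m where "m = nmem s0 ''m'' 0"
  define p where "p = nmem s0 ''ptr'' (ty m)"
  define w where "w = ord m p"
  define ptr' where "ptr' = (nmem s0 ''ptr'')(ty m := Suc p)"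
  have mn: "m < n" using inv nxt by (simp add: proposals_inv_def m_def)
  have offm: "nmem s0 ''off'' (nmem s0 ''wc'' m) = nmem s0 ''wc'' m * n"
    using off wc[OF mn] by simp
  have ordm: "bij_betw (ord m) {..<n} {..<n}" using ord mn by simp
  have "p < n" using proposals_ptr_less[OF inv nxt ordm[unfolded m_def]] by (simp add: p_def m_def)
  then have wn: "w < n" using bij_betwE[OF ordm] by (auto simp: w_def)
  note steps = proposals_step[OF inv[folded m_def] nxt ord ty w_def[unfolded p_def] ptr'_def[unfolded p_def]]
  define s1 where "s1 = nwrite ''ptr'' (ty m) (Suc p) (nwrite ''w'' 0 w (nwrite ''t'' 0 (ty m) s0))"
  have [simp]: "nmem s0 ''m'' 0 = m" by (simp add: m_def)
  let ?P = "\<lambda>s. proposals_inv n ty ord wv (nmem s ''mu'') (nmem s ''hus'') (nmem s ''ptr'') (nmem s ''m'' 0) (nmem s ''nxt'' 0) \<and>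
    nmem s ''ptr'' = ptr'"
  have start: "nwrite ''ptr'' (nval (NV ''t'') (nwrite ''w'' 0 w (nwrite ''t'' 0 (ty m) s0)))
      (nval (NPlus (NRead ''ptr'' (NV ''t'')) (NConst 1)) (nwrite ''w'' 0 w (nwrite ''t'' 0 (ty m) s0)))
      (nwrite ''w'' 0 w (nwrite ''t'' 0 (ty m) s0)) = s1"
    by (simp add: s1_def p_def)
  have r1: "nval (NPlus (NRead ''off'' (NRead ''wc'' (NV ''m''))) (NRead ''ac'' (NV ''m''))) s0 = ty m"
    by (simp add: offm ty_def)
  have r2: "nval (NRead ''order'' (NPlus (NRead ''off'' (NRead ''wc'' (NV ''m''))) (NRead ''ptr'' (NV ''t'')))) (nwrite ''t'' 0 (ty m) s0) = w"
    by (simp add: offm w_def ord_def p_def)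
  have "wp propose s0 (\<lambda>t s. t \<le> 6 * d + 15 \<and> ?P s)"
    unfolding propose_def wp_Seq wp_NWrite wp_If r1 nval.simps(1) r2 start
  proof (split if_split, (rule conjI; rule impI), goal_cases)
    case 1
    then obtain h where h: "nmem s0 ''hus'' w = Suc h" by (auto simp: s1_def gr0_conv_Suc)
    have hn: "h < n" using inv nxt h wn by (auto simp: proposals_inv_def)
    let ?s2 = "nwrite ''h'' 0 h s1"
    have s2: "nwrite ''h'' 0 (nval (NMinus (NRead ''hus'' (NV ''w'')) (NConst 1)) s1) s1 = ?s2"
      by (simp add: s1_def h)
    show ?case
      unfolding s2 nval.simps(1)
    proof (rule wp_mono[OF wp_dot[where n = n and d = d and f = f and g = g]], goal_cases)
      case (11 t1 s3)
      note fr1 = same_butD[OF 11[THEN conjunct2, THEN conjunct2], unfolded mods_dot]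
      have x: "rmem s3 ''x'' 0 = wv w h" using 11 by (simp add: s1_def wv)
      have t1: "t1 \<le> 3 * d + 3" using 11 by simp
      have s3: "nmem s3 ''w'' 0 = w" "nmem s3 ''m'' 0 = m" by (simp_all add: fr1 s1_def)
      show ?case
      proof (rule wp_mono[OF wp_dot[where n = n and d = d and f = f and g = g]], goal_cases)
        case (11 t2 s4)
        note fr2 = same_butD[OF 11[THEN conjunct2, THEN conjunct2], unfolded mods_dot]
        have y: "rmem s4 ''y'' 0 = wv w m" using 11 s3 by (simp add: wv)
        have t2: "t2 \<le> 3 * d + 3" using 11 by simp
        have "rmem s4 ''x'' 0 = wv w h" "nmem s4 ''mu'' = nmem s0 ''mu''" "nmem s4 ''hus'' = nmem s0 ''hus''" 
            "nmem s4 ''ptr'' = ptr'" "nmem s4 ''m'' 0 = m" "nmem s4 ''h'' 0 = h" "nmem s4 ''w'' 0 = w"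
            "nmem s4 ''nxt'' 0 = nmem s0 ''nxt'' 0"
          by (simp_all add: fr1 fr2 s1_def ptr'_def x)
        with y t1 t2 steps(2)[OF h] steps(3)[OF h] show ?case by simp
      qed (simp_all add: fr1 s1_def d row t mn wn)
    qed (simp_all add: s1_def d row t hn wn)
  next
    case 2
    then have "nmem s0 ''hus'' w = 0" by (simp add: s1_def)
    from steps(1)[OF this] show ?case by (simp add: s1_def ptr'_def fun_upd_def)
  qed
  from wp_same_but[OF this] show ?thesis 
    by (rule wp_mono) (auto simp: ptr'_def p_def)
qed

definition run_proposals :: com where
  "run_proposals = Seq (Assign ''m'' (NConst 0)) (Seq (Assign ''nxt'' (NConst 0))
     (While (NLess (NV ''nxt'') (NV ''n'')) propose))"

lemma wp_run_proposals:
  assumes ty_def: "ty = (\<lambda>k. nmem s0 ''wc'' k * n + nmem s0 ''ac'' k)"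
    and ord_def: "ord = (\<lambda>k i. nmem s0 ''order'' (nmem s0 ''wc'' k * n + i))"
    and d: "nmem s0 ''d'' 0 = d" and row: "\<forall>k\<le>n. nmem s0 ''row'' k = k * d"
    and n: "nmem s0 ''n'' 0 = n"
    and t: "rmem s0 ''woman_weight'' = table n d f" "rmem s0 ''man_attr'' = table n d g"
    and off: "\<forall>k\<le>n. nmem s0 ''off'' k = k * n"
    and wc: "\<And>k. k < n \<Longrightarrow> nmem s0 ''wc'' k < B" "B \<le> n"
    and ac: "\<And>k. k < n \<Longrightarrow> nmem s0 ''ac'' k < A"
    and wv: "\<And>w k. wv w k = (\<Sum>i<d. f w i * g k i)"
    and ord: "\<forall>k<n. bij_betw (ord k) {..<n} {..<n}"
    and ty: "\<forall>k<n. \<forall>l<n. ty k = ty l \<longrightarrow> ord k = ord l \<and> (\<forall>w<n. wv w k = wv w l)"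
    and zero: "nmem s0 ''ptr'' = (\<lambda>_. 0)" "nmem s0 ''hus'' = (\<lambda>_. 0)"
  shows "wp run_proposals s0 (\<lambda>t s. t \<le> B * A * n * (6 * d + 16) + 3 \<and>
    (\<exists>hus ptr m. proposals_inv n ty ord wv (nmem s ''mu'') hus ptr m n))"
proof -
  let ?I = "\<lambda>s. proposals_inv n ty ord wv (nmem s ''mu'') (nmem s ''hus'') (nmem s ''ptr'')
    (nmem s ''m'' 0) (nmem s ''nxt'' 0)"
  define T where "T = ty ` {..<n}"
  \<comment> \<open>Total distance of the pointers of all occurring types from \<open>n\<close>.
    Each proposal lowers it by one, which pays for at most \<open>6 * d + 15\<close> steps and the
    loop test.\<close>
  let ?left = "\<lambda>s. \<Sum>x\<in>T. n - nmem s ''ptr'' x"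
  let ?\<Phi> = "\<lambda>s. ?left s * (6 * d + 16)"
  define s1 where "s1 = nwrite ''nxt'' 0 0 (nwrite ''m'' 0 0 s0)"
  have "T \<subseteq> (\<lambda>(b, a). b * n + a) ` ({..<B} \<times> {..<A})"
    using wc(1) ac by (auto simp: T_def ty_def)
  from surj_card_le[OF _ this] have "card T \<le> B * A" by simp
  then have "?left s1 \<le> B * A * n" by (simp add: s1_def zero)
  then have \<Phi>1: "?\<Phi> s1 \<le> B * A * n * (6 * d + 16)" by (rule mult_le_mono1)
  have "wp (While (NLess (NV ''nxt'') (NV ''n'')) propose) s1
    (\<lambda>t s. t \<le> ?\<Phi> s1 + 1 \<and> ?I s \<and> \<not> bval (NLess (NV ''nxt'') (NV ''n'')) s \<and>
       same_but (nmods propose) (rmods propose) s1 s)"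
  proof (rule wp_While[where \<Phi> = ?\<Phi> and I = ?I], goal_cases)
    case (1 s)
    note fr = same_butD[OF 1(1), unfolded mods_propose]
    have nxt: "nmem s ''nxt'' 0 < n" using 1(3) by (simp add: fr s1_def n)
    define m where "m = nmem s ''m'' 0"
    have m: "m < n" using proposals_invD(1)[OF 1(2)] nxt by (simp add: m_def)
    have p: "nmem s ''ptr'' (ty m) < n"
      using proposals_ptr_less[OF 1(2) nxt] ord m by (simp add: m_def)
    show ?case
    proof (rule wp_mono[OF wp_propose[where ty = ty and ord = ord and wv = wv and d = d and n = n and f = f and g = g]], goal_cases)
      case (14 t s')
      then have ptr: "nmem s' ''ptr'' = (nmem s ''ptr'')(ty m := Suc (nmem s ''ptr'' (ty m)))"
        by (simp add: m_def)
      have T: "finite T" "ty m \<in> T" using m by (auto simp: T_def)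
      have "?left s = (n - nmem s ''ptr'' (ty m)) + (\<Sum>x\<in>T - {ty m}. n - nmem s ''ptr'' x)"
        by (rule sum.remove[OF T])
      moreover have "?left s' = (n - nmem s' ''ptr'' (ty m)) + (\<Sum>x\<in>T - {ty m}. n - nmem s' ''ptr'' x)"
        by (rule sum.remove[OF T])
      moreover have "n - nmem s ''ptr'' (ty m) = Suc (n - nmem s' ''ptr'' (ty m))"
        unfolding ptr using p by simp
      moreover have "(\<Sum>x\<in>T - {ty m}. n - nmem s' ''ptr'' x) = (\<Sum>x\<in>T - {ty m}. n - nmem s ''ptr'' x)"
        by (rule sum.cong) (auto simp: ptr)
      ultimately have "?left s = Suc (?left s')" by linarith
      then have "?\<Phi> s = ?\<Phi> s' + (6 * d + 16)" by simp
      moreover have "t \<le> 6 * d + 15" "?I s'" using 14 by blast+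
      ultimately show ?case by simp
    next
      case (8 k)
      then show ?case using wc(1)[of k] wc(2) by (simp add: fr s1_def)
    next
      case 10
      show ?case by (rule 1(2))
    next
      case 12
      show ?case by (rule ord)
    next
      case 13
      show ?case by (rule ty)
    qed (use nxt row off in \<open>simp_all add: fr s1_def d t wv ty_def ord_def\<close>)
  next
    case 2
    show ?case by (simp add: proposals_inv_def s1_def zero)
  qed
  then show ?thesis
    unfolding run_proposals_def wp_Seq wp_NWrite nval.simps s1_def[symmetric]
  proof (rule wp_mono, goal_cases)
    case (1 t s)
    have "nmem s ''n'' 0 = n"
      using same_butD(1)[OF 1[THEN conjunct2, THEN conjunct2, THEN conjunct2], of "''n''"]
      by (simp add: mods_propose s1_def n)
    then have "n \<le> nmem s ''nxt'' 0" using 1 by simp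
    moreover have t: "t \<le> ?\<Phi> s1 + 1" and inv: "?I s" using 1 by blast+
    moreover have "nmem s ''nxt'' 0 \<le> n" by (rule proposals_invD(2)[OF inv])
    ultimately have "nmem s ''nxt'' 0 = n" by simp
    moreover have "1 + (1 + t) \<le> B * A * n * (6 * d + 16) + 3" using t \<Phi>1 by linarith
    ultimately show ?case using inv by metis
  qed
qed

section \<open>The complete program and its running time\<close>

definition stable_matching_prog :: com where
  "stable_matching_prog =
     Seq (multiples ''row'' ''d'') (Seq (multiples ''off'' ''n'')
     (Seq (classify ''man_weight'' ''wc'' ''wrep'' ''wcnt'')
     (Seq (classify ''man_attr'' ''ac'' ''arep'' ''acnt'')
     (Seq sort_all run_proposals))))"

lemma wp_stable_matching_prog:
  assumes V: "finite V" "values_in X V"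
  defines "n \<equiv> nagents X" and "d \<equiv> nattrs X" and "D \<equiv> card V ^ nattrs X"
  shows "wp stable_matching_prog (input_state X) (\<lambda>t s.
    t \<le> 6 * n + 4 + 2 * (n * (D * (4 * d + 7) + 8) + 3) +
      (D * (n * (3 * d + 7) + D * (11 * n + 6) + 7) + 2) + (D * D * n * (6 * d + 16) + 3) \<and>
    stable_matching X (output_matching X s))"
proof -
  let ?f = "man_weight X" and ?g = "man_attr X"
  have in_V: "?f p i \<in> V" "?g p i \<in> V" "woman_attr X p i \<in> V" if "p < n" "i < d" for p i
    using V(2) that by (auto simp: values_in_def n_def d_def)
  define s0 where "s0 = input_state X"
  have s0: "nmem s0 ''n'' 0 = n" "nmem s0 ''d'' 0 = d"
      "nmem s0 ''row'' = (\<lambda>_. 0)" "nmem s0 ''off'' = (\<lambda>_. 0)" "nmem s0 ''ptr'' = (\<lambda>_. 0)" "nmem s0 ''hus'' = (\<lambda>_. 0)"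
      "rmem s0 ''man_weight'' = table n d ?f" "rmem s0 ''man_attr'' = table n d ?g"
      "rmem s0 ''woman_weight'' = table n d (woman_weight X)" "rmem s0 ''woman_attr'' = table n d (woman_attr X)"
    by (simp_all add: s0_def input_state_def n_def d_def)
  show ?thesis
    unfolding stable_matching_prog_def s0_def[symmetric] wp_Seq
  proof (rule wp_mono[OF wp_multiples[where n = n and d = d]], goal_cases)
    case (6 t1 s1)
    note fr1 = same_butD[OF 6[THEN conjunct2, THEN conjunct2], unfolded mods_multiples]
    have t1: "t1 \<le> n * 3 + 2" and row: "\<forall>k\<le>n. nmem s1 ''row'' k = k * d" using 6 by blast+
    show ?case
    proof (rule wp_mono[OF wp_multiples[where n = n and d = n]], goal_cases)
      case (6 t2 s2)
      note fr2 = same_butD[OF 6[THEN conjunct2, THEN conjunct2], unfolded mods_multiples]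
      have t2: "t2 \<le> n * 3 + 2" and off: "\<forall>k\<le>n. nmem s2 ''off'' k = k * n" using 6 by blast+
      show ?case
      proof (rule wp_mono[OF wp_classify[where d = d and n = n and V = V and f = ?f]], goal_cases)
        case (8 t3 s3)
        note fr3 = same_butD[OF 8[THEN conjunct2, THEN conjunct2], unfolded mods_classify]
        define B where "B = nmem s3 ''wcnt'' 0"
        have t3: "t3 \<le> n * (D * (4 * d + 7) + 8) + 3"
          and wc: "classified d ?f n (nmem s3 ''wc'') (nmem s3 ''wrep'') B"
          using 8 by (simp_all add: B_def D_def d_def)
        have B: "B \<le> n" "B \<le> D"
          using classified_card[OF wc V(1) in_V(1)] by (simp_all add: D_def d_def)
        show ?case
        proof (rule wp_mono[OF wp_classify[where d = d and n = n and V = V and f = ?g]], goal_cases)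
          case (8 t4 s4)
          note fr4 = same_butD[OF 8[THEN conjunct2, THEN conjunct2], unfolded mods_classify]
          define A where "A = nmem s4 ''acnt'' 0"
          have t4: "t4 \<le> n * (D * (4 * d + 7) + 8) + 3"
            and ac: "classified d ?g n (nmem s4 ''ac'') (nmem s4 ''arep'') A"
            using 8 by (simp_all add: A_def D_def d_def)
          have A: "A \<le> n" "A \<le> D"
            using classified_card[OF ac V(1) in_V(2)] by (simp_all add: D_def d_def)
          have s4: "nmem s4 ''wc'' = nmem s3 ''wc''" "nmem s4 ''wrep'' = nmem s3 ''wrep''" "nmem s4 ''wcnt'' 0 = B"
            by (simp_all add: fr4 B_def)
          show ?case
          proof (rule wp_mono[OF wp_sort_all[where d = d and n = n and V = V and B = B and f = ?f and g = "woman_attr X"]], goal_cases)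
            case (12 t5 s5)
            note fr5 = same_butD[OF 12[THEN conjunct2, THEN conjunct2], unfolded mods_sort_all mods_sort_women]
            define ty where "ty = (\<lambda>k. nmem s5 ''wc'' k * n + nmem s5 ''ac'' k)"
            define ord where "ord = (\<lambda>k i. nmem s5 ''order'' (nmem s5 ''wc'' k * n + i))"
            have s5: "nmem s5 ''wc'' = nmem s3 ''wc''" "nmem s5 ''ac'' = nmem s4 ''ac''"
              by (simp_all add: fr5 s4)
            have wc_less: "nmem s5 ''wc'' k < B" and wc_row: "same_row d ?f k (nmem s3 ''wrep'' (nmem s5 ''wc'' k))"
              and ac_less: "nmem s5 ''ac'' k < A" and ac_row: "same_row d ?g k (nmem s4 ''arep'' (nmem s5 ''ac'' k))"
              if "k < n" for k using wc ac that by (auto simp: classified_def s5)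
            \<comment> \<open>The ranking was computed from the weights of the representative, which
              agree with those of \<open>k\<close> on the indices that count.\<close>
            have sorted: "sorted_order (man_val X k) n (ord k)" if "k < n" for k
            proof (rule sorted_order_cong)
              show "sorted_order (\<lambda>w. \<Sum>i<d. ?f (nmem s4 ''wrep'' (nmem s5 ''wc'' k)) i * woman_attr X w i) n (ord k)"
                using 12 wc_less[OF that] by (simp add: ord_def)
              show "(\<Sum>i<d. ?f (nmem s4 ''wrep'' (nmem s5 ''wc'' k)) i * woman_attr X w i) = man_val X k w" for w
                using wc_row[OF that] by (simp add: man_val_def same_row_def s4 d_def)
            qed simp
            have ty: "ord k = ord l \<and> (\<forall>w<n. woman_val X w k = woman_val X w l)"
              if "k < n" "l < n" "ty k = ty l" for k l
            proof -
              \<comment> \<open>Attribute classes are below \<open>n\<close>, so division by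
                \<open>n\<close> with remainder recovers both classes from the type number.\<close>
              have "nmem s5 ''ac'' k < n" "nmem s5 ''ac'' l < n"
                using ac_less A(1) that by (auto intro: less_le_trans)
              then have "nmem s5 ''ac'' k = nmem s5 ''ac'' l" "nmem s5 ''wc'' k = nmem s5 ''wc'' l"
                using arg_cong[OF that(3), of "\<lambda>x. x mod n"] arg_cong[OF that(3), of "\<lambda>x. x div n"]
                by (simp_all add: ty_def)
              moreover from this have "?g k i = ?g l i" if "i < d" for i
                using ac_row[OF \<open>k < n\<close>] ac_row[OF \<open>l < n\<close>] that by (simp add: same_row_def)
              ultimately show ?thesis by (simp add: ord_def woman_val_def d_def)
            qed
            have "t5 \<le> B * (n * (3 * d + 7) + card V ^ d * (11 * n + 6) + 7) + 2" using 12 by blast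
            also have "\<dots> \<le> D * (n * (3 * d + 7) + D * (11 * n + 6) + 7) + 2"
              using B(2) by (simp add: D_def d_def)
            finally have t5: "t5 \<le> D * (n * (3 * d + 7) + D * (11 * n + 6) + 7) + 2" .
            show ?case
            proof (rule wp_mono[OF wp_run_proposals[where ty = ty and ord = ord and d = d and n = n and A = A and B = B
                and f = "woman_weight X" and g = ?g and wv = "woman_val X"]], goal_cases)
              case (17 t6 s6)
              have "B * A * n * (6 * d + 16) \<le> D * D * n * (6 * d + 16)"
                using A(2) B(2) by (intro mult_le_mono) auto
              with 17 have t6: "t6 \<le> D * D * n * (6 * d + 16) + 3" by linarith
              obtain hus ptr m where "proposals_inv n ty ord (woman_val X) (nmem s6 ''mu'') hus ptr m n"
                using 17 by blast
              from proposals_stable[OF this n_def[THEN meta_eq_to_obj_eq] sorted]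
              have "stable_matching X (output_matching X s6)"
                by (simp add: output_matching_def n_def)
              with t1 t2 t3 t4 t5 t6 show ?case by simp
            next
              case 1
              show ?case by (rule ty_def)
            next
              case 2
              show ?case by (rule ord_def)
            next
              case (9 k)
              then show ?case by (rule wc_less)
            next
              case (11 k)
              then show ?case by (rule ac_less)
            next
              case (12 w k)
              show ?case by (simp add: woman_val_def d_def)
            next
              case 13
              show ?case using sorted by (simp add: sorted_order_def)
            next
              case 14
              show ?case using ty by blast
            qed (use row off in \<open>simp_all add: fr1 fr2 fr3 fr4 fr5 s0 B\<close>)
          next
            case 4
            show ?case by (rule s4(3))
          next
            case (6 b)
            then show ?case using wc by (simp add: classified_def s4)
          qed (use B off row in_V in \<open>auto simp: fr1 fr2 fr3 fr4 s0 V(1)\<close>)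
        qed (use row in_V in \<open>auto simp: fr1 fr2 fr3 s0 V(1)\<close>)
      qed (use row in_V in \<open>auto simp: fr1 fr2 s0 V(1)\<close>)
    qed (simp_all add: fr1 s0)
  qed (simp_all add: s0)
qed

text \<open>Each term is dominated by a multiple of \<open>?M\<close>; the coefficients add up to
  98, and 110 leaves some slack. The factor \<open>d + 1\<close> instead of \<open>d\<close> keeps
  \<open>?M\<close> positive when there are no attributes.\<close>

lemma total_time_le:
  fixes n d D :: nat
  assumes "1 \<le> n" "1 \<le> D"
  shows "6 * n + 4 + 2 * (n * (D * (4 * d + 7) + 8) + 3) +
      (D * (n * (3 * d + 7) + D * (11 * n + 6) + 7) + 2) + (D * D * n * (6 * d + 16) + 3)
     \<le> 110 * (D * D * n * (d + 1))"
proof -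
  let ?M = "D * D * n * (d + 1)"
  have D: "D \<le> D * D" using assms by simp
  have DDn: "D * D * n * 1 \<le> ?M" by (rule mult_le_mono) auto
  have DD: "D * D * 1 \<le> D * D * n" by (rule mult_le_mono) (use assms in auto)
  have n: "1 * n \<le> D * D * n" by (rule mult_le_mono) (use assms in auto)
  have Dnd: "D * n * (d + 1) \<le> ?M" using D by (intro mult_le_mono) auto
  have "6 * n + 4 + 2 * (n * (D * (4 * d + 7) + 8) + 3) +
      (D * (n * (3 * d + 7) + D * (11 * n + 6) + 7) + 2) + (D * D * n * (6 * d + 16) + 3)
    = 22 * n + 15 + 8 * (D * n * d) + 14 * (D * n) + 3 * (D * n * d) + 7 * (D * n) + 11 * (D * D * n) + 6 * (D * D)
      + 7 * D + 6 * (D * D * n * d) + 16 * (D * D * n)"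
    by (simp add: algebra_simps)
  also have "\<dots> \<le> 22 * ?M + 15 * ?M + (8 * (D * n * d) + 14 * (D * n) + 3 * (D * n * d) + 7 * (D * n))
      + 11 * ?M + 6 * ?M + 7 * ?M + 6 * (D * D * n * d) + 16 * (D * D * n)"
    using D DDn DD n assms by linarith
  also have "\<dots> \<le> 22 * ?M + 15 * ?M + 21 * (D * n * (d + 1)) + 11 * ?M + 6 * ?M + 7 * ?M + 16 * ?M"
    by (simp add: algebra_simps)
  also have "\<dots> \<le> 110 * ?M" using Dnd by linarith
  finally show ?thesis .
qed

theorem theorem1:
  fixes C :: nat
  shows "\<exists>prog :: com. \<exists>K :: real. \<forall>(X :: market) (V :: real set).
    finite V \<and> card V \<le> C \<and> values_in X V \<longrightarrow>
    (\<exists>t s. exec prog (input_state X) t s \<and>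
       stable_matching X (output_matching X s) \<and>
       (nagents X \<ge> 2 \<or> nagents X = 1 \<and> nattrs X \<ge> 1 \<longrightarrow>
          real t \<le> K * (real C ^ (2 * nattrs X) * real (nagents X) *
                        (real (nattrs X) + log 2 (real (nagents X))))))"
\<comment> \<open>220 is twice the 110 of the step bound, and the doubling replaces
  \<open>d + 1\<close> by \<open>d + log 2 n\<close>. Neither witness depends on
  \<open>C\<close>.\<close>
proof (rule exI[of _ stable_matching_prog], rule exI[of _ 220], intro allI impI)
  fix X V
  assume "finite V \<and> card V \<le> C \<and> values_in X V"
  then have V: "finite V" "card V \<le> C" "values_in X V" by auto
  define n d D where "n = nagents X" and "d = nattrs X" and "D = card V ^ d"
  obtain t s where e: "exec stable_matching_prog (input_state X) t s"
    and st: "stable_matching X (output_matching X s)"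
    and t: "t \<le> 6 * n + 4 + 2 * (n * (D * (4 * d + 7) + 8) + 3) +
      (D * (n * (3 * d + 7) + D * (11 * n + 6) + 7) + 2) + (D * D * n * (6 * d + 16) + 3)"
    using wp_stable_matching_prog[OF V(1,3)] unfolding wp_def n_def d_def D_def by blast
  have "real t \<le> 220 * (real C ^ (2 * d) * real n * (real d + log 2 (real n)))"
    if n: "n \<ge> 2 \<or> n = 1 \<and> d \<ge> 1"
  proof -
    \<comment> \<open>\<open>V\<close> may be empty, but only without attributes, and then
      \<open>D\<close> is an empty product.\<close>
    have "1 \<le> D"
    proof (cases "d = 0")
      case False
      then have "man_attr X 0 0 \<in> V" using V(3) n by (auto simp: values_in_def n_def d_def)
      then have "0 < card V" using V(1) by (auto simp: card_gt_0_iff)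
      then show ?thesis by (simp add: D_def Suc_le_eq)
    qed (simp add: D_def)
    then have "t \<le> 110 * (D * D * n * (d + 1))"
      using total_time_le[of n D d] t n by linarith
    also have "D * D \<le> C ^ (2 * d)"
      unfolding D_def mult_2 power_add using V(2) by (intro mult_le_mono power_mono) auto
    then have "110 * (D * D * n * (d + 1)) \<le> 110 * (C ^ (2 * d) * n * (d + 1))"
      by (intro mult_le_mono) auto
    finally have "real t \<le> real (110 * (C ^ (2 * d) * n * (d + 1)))" by (simp only: of_nat_le_iff)
    also have "\<dots> = 110 * (real C ^ (2 * d) * real n) * (real d + 1)" by (simp add: algebra_simps)
    also have "\<dots> \<le> 110 * (real C ^ (2 * d) * real n) * (2 * (real d + log 2 (real n)))"
    proof (rule mult_left_mono)
      \<comment> \<open>For \<open>n \<ge> 2\<close> the logarithm is at least 1; for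
        \<open>n = 1\<close> it vanishes and \<open>d \<ge> 1\<close> does the work. In the excluded
        cases the claimed bound would be 0, while every run takes at least one step.\<close>
      show "real d + 1 \<le> 2 * (real d + log 2 (real n))"
      proof (cases "n \<ge> 2")
        case True
        then have "1 \<le> log 2 (real n)" by (simp add: le_log_iff)
        then show ?thesis by simp
      qed (use n in auto)
    qed simp
    finally show ?thesis by (simp add: algebra_simps)
  qed
  with e st show "\<exists>t s. exec stable_matching_prog (input_state X) t s \<and>
       stable_matching X (output_matching X s) \<and>
       (nagents X \<ge> 2 \<or> nagents X = 1 \<and> nattrs X \<ge> 1 \<longrightarrow>
          real t \<le> 220 * (real C ^ (2 * nattrs X) * real (nagents X) *
                        (real (nattrs X) + log 2 (real (nagents X)))))"
    unfolding n_def d_def by blast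
qed

end
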